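(* (Tubular Milnor fibration) Let $f(\mathbf z,\bar{\mathbf z})$ be a strongly non-degenerate mixed polynomial in $n$ complex variables which is locally tame along its vanishing coordinate subspaces. Let $\rho_0$ and, for $0<r\le\rho_0$, $\delta(r)>0$ be the numbers described in the context. Take positive numbers $r\le\rho_0$ and $\delta_0\le\delta(r)$, and put $$D(\delta_0)^*=\{\eta\in\mathbb C: 0<|\eta|\le\delta_0\},\qquad S^1_{\delta_0}=\{\eta\in\mathbb C:|\eta|=\delta_0\},$$ $$E(r,\delta_0)^*=f^{-1}(D(\delta_0)^* )\cap B_r,\qquad \partial E(r,\delta_0)^*=f^{-1}(S^1_{\delta_0})\cap B_r.$$ Then $f:E(r,\delta_0)^*\to D(\delta_0)^*$ and $f:\partial E(r,\delta_0)^*\to S^1_{\delta_0}$ are locally trivial fibrations, and their topological isomorphism class does not depend on the choice of $\delta_0$ and $r$.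
   Context: A mixed polynomial is a finite sum $f(\mathbf z,\bar{\mathbf z})=\sum_{\nu,\mu}c_{\nu\mu}\mathbf z^\nu\bar{\mathbf z}^\mu$ with $\mathbf z\in\mathbb C^n$, $\nu,\mu\in\mathbb Z_{\ge0}^n$, viewed as a real analytic map $f:\mathbb C^n=\mathbb R^{2n}\to\mathbb C=\mathbb R^2$. A critical point of such a map is a point where the real differential has rank $<2$; a mixed singularity of $f^{-1}(\eta)$ is a critical point of $f$ lying on $f^{-1}(\eta)$. $V=f^{-1}(0)$; $B_r$ and $S_r$ are the closed ball and the sphere of radius $r$ centered at the origin of $\mathbb C^n$. For $I\subset\{1,\dots,n\}$: $\mathbb C^I=\{\mathbf z: z_j=0\ \forall j\notin I\}$, $\mathbb C^{*I}=\{\mathbf z\in\mathbb C^I: z_j\ne0\ \forall j\in I\}$, $\mathbb C^{*n}=(\mathbb C\setminus\{0\})^n$, $f^I=f|_{\mathbb C^I}$, $I^c$ is the complement. $\mathcal I_{nv}(f)=\{I: f^I\not\equiv0\}$ and $\mathcal I_v(f)=\{I\neq\emptyset: f^I\equiv0\}$. For $I\in\mathcal I_v(f)$, $\mathbb C^I$ is called a vanishing coordinate subspace. Newton boundary: $\Gamma_+(f)$ is the convex hull of $\bigcup_{c_{\nu\mu}\ne0}(\nu+\mu+\mathbb R_{\ge0}^n)$, and $\Gamma(f)$ is the union of its compact faces. For a non-negative weight vector $P={}^t(p_1,\dots,p_n)$ let $d(P)$ be the minimum of $\xi\mapsto\sum p_i\xi_i$ on $\Gamma_+(f)$, $\Delta(P)$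 the face where it is attained, and $I(P)=\{i: p_i=0\}$. A non-compact face $\Xi$ of $\Gamma_+(f)$ is essential if there is a non-negative weight $P$ with $\Delta(P)=\Xi$, $f^{I(P)}\equiv0$, and $\nu+\mathbb R_{\ge0}E_i\subset\Xi$ for all $i\in I(P)$, $\nu\in\Xi$ ($E_i$ the $i$-th unit vector). $I(P)$ depends only on $\Xi$ and is denoted $I(\Xi)$. $\Gamma_{nc}(f)$ is $\Gamma(f)$ together with all essential non-compact faces. For a face $\Delta$, $f_\Delta=\sum_{\nu+\mu\in\Delta}c_{\nu\mu}\mathbf z^\nu\bar{\mathbf z}^\mu$. $f$ is strongly non-degenerate if (i) for every compact face $\Delta\subset\Gamma_{nc}(f)$, $f_\Delta:\mathbb C^{*n}\to\mathbb C$ has no critical point, and (ii) for every non-compact face $\Delta\in\Gamma_{nc}(f)$, $f_{\Delta_0}:\mathbb C^{*n}\to\mathbb C$ has no critical point, where $\Delta_0=\Delta\cap\Gamma(f)$. Local tameness: for an essential non-compact face $\Delta$ put $\rho_\Delta(\mathbf z)=\sum_{j\in I(\Delta)}|z_j|^2$ and $V_\Delta^*=f_\Delta^{-1}(0)\cap\mathbb C^{*n}$. $f_\Delta$ is locally tame if there is $r_\Delta>0$ such that for any fixed nonzero values $z_j\ (j\in I(\Delta))$ with $\rho_\Delta(\mathbf z)\le r_\Delta^2$, $f_\Delta$, as a mixed polynomial function of the remaining variables $\{z_k: k\notin I(\Delta)\}$, has no critical points in $\mathbb C^{*I(\Delta)^c}$; moreover $r_\Delta$ is chosen (possible, after shrinking,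 because $f$ is a polynomial) so that $\rho_\Delta|_{V_\Delta^*}$ has no critical value in $(0,r_\Delta^2]$. $f$ is locally tame on $\mathbb C^I$ if every $f_\Delta$ with $\Delta$ essential non-compact and $I(\Delta)=I$ is locally tame; $f$ is locally tame along vanishing coordinate subspaces if this holds for every $I\in\mathcal I_v(f)$. Fixing such $r_\Delta$, put $r_I=\min\{r_\Delta: I(\Delta)=I\}$ and $r_{nc}=\min\{r_I: I\in\mathcal I_v(f)\}$ ($=+\infty$ if there are no such $I$). The number $r_0>0$ is fixed so that: for every $I\in\mathcal I_{nv}(f)$, $V\cap\mathbb C^{*I}$ is non-singular in $B_{r_0}$ and transverse to $S_r$ for all $0<r\le r_0$; $V^\sharp=\bigcup_{I\in\mathcal I_{nv}(f)}V\cap\mathbb C^{*I}$ is likewise non-singular in $B_{r_0}$; and there is $\delta>0$ such that $f^{-1}(\eta)$ has no mixed singularity in $B_{r_0}$ for $0<|\eta|\le\delta$. Put $\rho_0=\min\{r_{nc},r_0\}$. For $0<r\le\rho_0$, $\delta(r)>0$ denotes a number such that for all $\eta$ with $0<|\eta|\le\delta(r)$ the fiber $f^{-1}(\eta)$ has no mixed singularity in $B_{\rho_0}$ and is transverse to $S_{r'}$ for every $r\le r'\le\rho_0$ (such numbers $r_0$ and $\delta(r)$ exist under the hypotheses of the claim). *)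

theory Defs
  imports "HOL-Analysis.Analysis" "HOL-Library.Poly_Mapping"
begin

section \<open>Mixed polynomials and their critical points\<close>

text \<open>The key \<open>(\<nu>, \<mu>)\<close> stands for the monomial with holomorphic exponent \<open>\<nu>\<close> and
  antiholomorphic exponent \<open>\<mu>\<close>.\<close>

type_synonym 'n mixed_poly = "(('n \<Rightarrow> nat) \<times> ('n \<Rightarrow> nat)) \<Rightarrow>\<^sub>0 complex"

definition mixed_eval :: "'n mixed_poly \<Rightarrow> complex ^ 'n::finite \<Rightarrow> complex" where
  "mixed_eval f z = (\<Sum>(\<nu>, \<mu>) \<in> Poly_Mapping.keys f.
     Poly_Mapping.lookup f (\<nu>, \<mu>) * (\<Prod>i\<in>UNIV. (z $ i) ^ \<nu> i * (cnj (z $ i)) ^ \<mu> i))"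

definition coord_space :: "'n set \<Rightarrow> (complex ^ 'n::finite) set" where
  "coord_space I = {z. \<forall>j. j \<notin> I \<longrightarrow> z $ j = 0}"

definition coord_torus :: "'n set \<Rightarrow> (complex ^ 'n::finite) set" where
  "coord_torus I = {z \<in> coord_space I. \<forall>j\<in>I. z $ j \<noteq> 0}"

text \<open>For a real subspace \<open>L\<close>, the differential at \<open>z\<close> of \<open>g\<close> restricted to \<open>z + L\<close> is the
  restriction to \<open>L\<close> of the differential of \<open>g\<close>; \<open>L = UNIV\<close> gives critical points in the usual
  sense.\<close>

definition critical_along ::
    "(complex ^ 'n::finite) set \<Rightarrow> (complex ^ 'n \<Rightarrow> complex) \<Rightarrow> complex ^ 'n \<Rightarrow> bool" where
  "critical_along L g z \<longleftrightarrow> dim (frechet_derivative g (at z) ` L) < 2"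

abbreviation critical_point :: "(complex ^ 'n::finite \<Rightarrow> complex) \<Rightarrow> complex ^ 'n \<Rightarrow> bool" where
  "critical_point \<equiv> critical_along UNIV"

text \<open>Tangent space at a non-critical point \<open>z\<close> of the fiber of the restriction of \<open>g\<close> to \<open>z + L\<close>.\<close>

definition fiber_tangent ::
    "(complex ^ 'n::finite) set \<Rightarrow> (complex ^ 'n \<Rightarrow> complex) \<Rightarrow> complex ^ 'n \<Rightarrow> (complex ^ 'n) set"
  where "fiber_tangent L g z = {v \<in> L. frechet_derivative g (at z) v = 0}"

text \<open>\<open>M\<close> is a part of a fiber of the restriction of \<open>g\<close> to \<open>L\<close>. The tangent space of the sphere at
  \<open>z\<close> is the orthogonal complement of \<open>z\<close> for the real inner product. Transversality inside \<open>L\<close>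
  and inside the whole space amount to the same thing, because the sphere is centered at the origin.\<close>

definition transverse_to_sphere ::
    "(complex ^ 'n::finite) set \<Rightarrow> (complex ^ 'n \<Rightarrow> complex) \<Rightarrow> (complex ^ 'n) set \<Rightarrow> real \<Rightarrow> bool"
  where
  "transverse_to_sphere L g M r \<longleftrightarrow>
     (\<forall>z \<in> M \<inter> sphere 0 r. {a + b | a b. a \<in> fiber_tangent L g z \<and> z \<bullet> b = 0} = UNIV)"

definition nonvanishing_subsets :: "'n::finite mixed_poly \<Rightarrow> 'n set set" where
  "nonvanishing_subsets f = {I. \<exists>z \<in> coord_space I. mixed_eval f z \<noteq> 0}"

definition vanishing_subsets :: "'n::finite mixed_poly \<Rightarrow> 'n set set" where
  "vanishing_subsets f = {I. I \<noteq> {} \<and> (\<forall>z \<in> coord_space I. mixed_eval f z = 0)}"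

section \<open>Newton boundary\<close>

definition exponent :: "('n \<Rightarrow> nat) \<times> ('n \<Rightarrow> nat) \<Rightarrow> real ^ 'n::finite" where
  "exponent k = (\<chi> i. real (fst k i + snd k i))"

definition newton_polyhedron :: "'n::finite mixed_poly \<Rightarrow> (real ^ 'n) set" where
  "newton_polyhedron f = convex hull (\<Union>k \<in> Poly_Mapping.keys f. {exponent k + \<xi> | \<xi>. \<forall>i. 0 \<le> \<xi> $ i})"

definition compact_newton_face :: "'n::finite mixed_poly \<Rightarrow> (real ^ 'n) set \<Rightarrow> bool" where
  "compact_newton_face f \<Delta> \<longleftrightarrow> \<Delta> \<noteq> {} \<and> \<Delta> face_of newton_polyhedron f \<and> compact \<Delta>"

definition newton_boundary :: "'n::finite mixed_poly \<Rightarrow> (real ^ 'n) set" where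
  "newton_boundary f = \<Union> {\<Delta>. compact_newton_face f \<Delta>}"

definition weight_face :: "'n::finite mixed_poly \<Rightarrow> real ^ 'n \<Rightarrow> (real ^ 'n) set" where
  "weight_face f P = {\<xi> \<in> newton_polyhedron f. \<forall>\<xi>' \<in> newton_polyhedron f. P \<bullet> \<xi> \<le> P \<bullet> \<xi>'}"

definition weight_zeros :: "real ^ 'n::finite \<Rightarrow> 'n set" where
  "weight_zeros P = {i. P $ i = 0}"

text \<open>\<open>essential_face f I \<Xi>\<close>: the face \<open>\<Xi>\<close> is essential non-compact and \<open>I(\<Xi>) = I\<close>. As a relation
  this needs no choice of the weight: the index set \<open>I\<close> is determined by \<open>\<Xi>\<close>.\<close>

definition essential_face :: "'n::finite mixed_poly \<Rightarrow> 'n set \<Rightarrow> (real ^ 'n) set \<Rightarrow> bool" where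
  "essential_face f I \<Xi> \<longleftrightarrow>
     \<Xi> \<noteq> {} \<and> \<Xi> face_of newton_polyhedron f \<and> \<not> compact \<Xi> \<and>
     (\<exists>P. (\<forall>i. 0 \<le> P $ i) \<and> weight_face f P = \<Xi> \<and> weight_zeros P = I \<and>
          (\<forall>z \<in> coord_space I. mixed_eval f z = 0) \<and>
          (\<forall>i \<in> I. \<forall>\<nu> \<in> \<Xi>. \<forall>t \<ge> 0. \<nu> + t *\<^sub>R axis i 1 \<in> \<Xi>))"

definition face_part :: "'n::finite mixed_poly \<Rightarrow> (real ^ 'n) set \<Rightarrow> 'n mixed_poly" where
  "face_part f \<Delta> = Poly_Mapping.mapp (\<lambda>k c. if exponent k \<in> \<Delta> then c else 0) f"

abbreviation face_fun :: "'n::finite mixed_poly \<Rightarrow> (real ^ 'n) set \<Rightarrow> complex ^ 'n \<Rightarrow> complex" where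
  "face_fun f \<Delta> \<equiv> mixed_eval (face_part f \<Delta>)"

definition strongly_nondegenerate :: "'n::finite mixed_poly \<Rightarrow> bool" where
  "strongly_nondegenerate f \<longleftrightarrow>
     (\<forall>\<Delta>. compact_newton_face f \<Delta> \<longrightarrow>
        (\<forall>z \<in> coord_torus UNIV. \<not> critical_point (face_fun f \<Delta>) z)) \<and>
     (\<forall>I \<Delta>. essential_face f I \<Delta> \<longrightarrow>
        (\<forall>z \<in> coord_torus UNIV. \<not> critical_point (face_fun f (\<Delta> \<inter> newton_boundary f)) z))"

section \<open>Local tameness\<close>

definition partial_sqnorm :: "'n set \<Rightarrow> complex ^ 'n::finite \<Rightarrow> real" where
  "partial_sqnorm I z = (\<Sum>j\<in>I. (cmod (z $ j))\<^sup>2)"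

definition tame_within :: "'n::finite mixed_poly \<Rightarrow> 'n set \<Rightarrow> (real ^ 'n) set \<Rightarrow> real \<Rightarrow> bool" where
  "tame_within f I \<Delta> r \<longleftrightarrow>
     (\<forall>z \<in> coord_torus UNIV. partial_sqnorm I z \<le> r\<^sup>2 \<longrightarrow>
        \<not> critical_along (coord_space (- I)) (face_fun f \<Delta>) z)"

definition locally_tame_on :: "'n::finite mixed_poly \<Rightarrow> 'n set \<Rightarrow> bool" where
  "locally_tame_on f I \<longleftrightarrow> (\<forall>\<Delta>. essential_face f I \<Delta> \<longrightarrow> (\<exists>r>0. tame_within f I \<Delta> r))"

definition locally_tame_along_vanishing :: "'n::finite mixed_poly \<Rightarrow> bool" where
  "locally_tame_along_vanishing f \<longleftrightarrow> (\<forall>I \<in> vanishing_subsets f. locally_tame_on f I)"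

text \<open>The admissible values of \<open>r\<^sub>\<Delta>\<close>. In the last clause the points \<open>z\<close> lie on the torus part of the
  zero set of the face function, which is smooth there by tameness; \<open>z\<close> is a non-critical point of the
  restriction of \<open>partial_sqnorm I\<close> to this manifold.\<close>

definition tame_radius :: "'n::finite mixed_poly \<Rightarrow> 'n set \<Rightarrow> (real ^ 'n) set \<Rightarrow> real \<Rightarrow> bool" where
  "tame_radius f I \<Delta> r \<longleftrightarrow>
     0 < r \<and> tame_within f I \<Delta> r \<and>
     (\<forall>z \<in> coord_torus UNIV.
        face_fun f \<Delta> z = 0 \<and> 0 < partial_sqnorm I z \<and> partial_sqnorm I z \<le> r\<^sup>2 \<longrightarrow>
        (\<exists>v \<in> fiber_tangent UNIV (face_fun f \<Delta>) z.
           frechet_derivative (partial_sqnorm I) (at z) v \<noteq> 0))"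

section \<open>The radii\<close>

text \<open>The infima run over finite sets, so they are minima; the infimum of the empty set is \<open>\<infinity>\<close>.\<close>

definition r_sub :: "'n::finite mixed_poly \<Rightarrow> ((real ^ 'n) set \<Rightarrow> real) \<Rightarrow> 'n set \<Rightarrow> ereal" where
  "r_sub f r\<Delta> I = (INF \<Delta> \<in> {\<Delta>. essential_face f I \<Delta>}. ereal (r\<Delta> \<Delta>))"

definition r_nc :: "'n::finite mixed_poly \<Rightarrow> ((real ^ 'n) set \<Rightarrow> real) \<Rightarrow> ereal" where
  "r_nc f r\<Delta> = (INF I \<in> vanishing_subsets f. r_sub f r\<Delta> I)"

definition rho_zero :: "'n::finite mixed_poly \<Rightarrow> ((real ^ 'n) set \<Rightarrow> real) \<Rightarrow> real \<Rightarrow> real" where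
  "rho_zero f r\<Delta> r\<^sub>0 = real_of_ereal (min (r_nc f r\<Delta>) (ereal r\<^sub>0))"

definition sharp_part :: "'n::finite mixed_poly \<Rightarrow> (complex ^ 'n) set" where
  "sharp_part f = (\<Union>I \<in> nonvanishing_subsets f. mixed_eval f -` {0} \<inter> coord_torus I)"

definition stable_radius :: "'n::finite mixed_poly \<Rightarrow> real \<Rightarrow> bool" where
  "stable_radius f r\<^sub>0 \<longleftrightarrow>
     0 < r\<^sub>0 \<and>
     (\<forall>I \<in> nonvanishing_subsets f.
        (\<forall>z \<in> mixed_eval f -` {0} \<inter> coord_torus I \<inter> cball 0 r\<^sub>0.
           \<not> critical_along (coord_space I) (mixed_eval f) z) \<and>
        (\<forall>r. 0 < r \<and> r \<le> r\<^sub>0 \<longrightarrow>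
           transverse_to_sphere (coord_space I) (mixed_eval f)
             (mixed_eval f -` {0} \<inter> coord_torus I) r)) \<and>
     (\<forall>z \<in> sharp_part f \<inter> cball 0 r\<^sub>0. \<not> critical_point (mixed_eval f) z) \<and>
     (\<exists>\<delta>>0. \<forall>\<eta>. 0 < cmod \<eta> \<and> cmod \<eta> \<le> \<delta> \<longrightarrow>
        (\<forall>z \<in> mixed_eval f -` {\<eta>} \<inter> cball 0 r\<^sub>0. \<not> critical_point (mixed_eval f) z))"

text \<open>\<open>d\<close> is an admissible value of \<open>\<delta>(r)\<close>, for \<open>\<rho> = \<rho>\<^sub>0\<close>.\<close>

definition stable_level :: "'n::finite mixed_poly \<Rightarrow> real \<Rightarrow> real \<Rightarrow> real \<Rightarrow> bool" where
  "stable_level f \<rho> r d \<longleftrightarrow>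
     0 < d \<and>
     (\<forall>\<eta>. 0 < cmod \<eta> \<and> cmod \<eta> \<le> d \<longrightarrow>
        (\<forall>z \<in> mixed_eval f -` {\<eta>} \<inter> cball 0 \<rho>. \<not> critical_point (mixed_eval f) z) \<and>
        (\<forall>r'. r \<le> r' \<and> r' \<le> \<rho> \<longrightarrow>
           transverse_to_sphere UNIV (mixed_eval f) (mixed_eval f -` {\<eta>}) r'))"

section \<open>Tubes and fibrations\<close>

definition punctured_disc :: "real \<Rightarrow> complex set" where
  "punctured_disc \<delta> = {\<eta>. 0 < cmod \<eta> \<and> cmod \<eta> \<le> \<delta>}"

definition tube :: "'n::finite mixed_poly \<Rightarrow> real \<Rightarrow> real \<Rightarrow> (complex ^ 'n) set" where
  "tube f r \<delta> = mixed_eval f -` punctured_disc \<delta> \<inter> cball 0 r"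

definition tube_boundary :: "'n::finite mixed_poly \<Rightarrow> real \<Rightarrow> real \<Rightarrow> (complex ^ 'n) set" where
  "tube_boundary f r \<delta> = mixed_eval f -` sphere 0 \<delta> \<inter> cball 0 r"

definition locally_trivial_fibration ::
    "('a::topological_space \<Rightarrow> 'b::topological_space) \<Rightarrow> 'a set \<Rightarrow> 'b set \<Rightarrow> bool" where
  "locally_trivial_fibration p E B \<longleftrightarrow>
     continuous_on E p \<and> p ` E = B \<and>
     (\<forall>b \<in> B. \<exists>U \<phi> \<psi>. b \<in> U \<and> openin (top_of_set B) U \<and>
        homeomorphism (U \<times> (E \<inter> p -` {b})) (E \<inter> p -` U) \<phi> \<psi> \<and>
        (\<forall>u \<in> U. \<forall>x \<in> E \<inter> p -` {b}. p (\<phi> (u, x)) = u))"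

text \<open>Topological isomorphism of \<open>p : E \<rightarrow> B\<close> and \<open>p' : E' \<rightarrow> B'\<close> covering the homeomorphism \<open>\<sigma>\<close> of the
  bases.\<close>

definition fibration_isomorphic_over ::
    "('b::topological_space \<Rightarrow> 'd::topological_space) \<Rightarrow>
     ('a::topological_space \<Rightarrow> 'b) \<Rightarrow> 'a set \<Rightarrow> 'b set \<Rightarrow>
     ('c::topological_space \<Rightarrow> 'd) \<Rightarrow> 'c set \<Rightarrow> 'd set \<Rightarrow> bool" where
  "fibration_isomorphic_over \<sigma> p E B p' E' B' \<longleftrightarrow>
     (\<exists>\<tau>. homeomorphism B B' \<sigma> \<tau>) \<and>
     (\<exists>h k. homeomorphism E E' h k \<and> (\<forall>x \<in> E. p' (h x) = \<sigma> (p x)))"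

end

theory Submission
  imports Defs "HOL-Computational_Algebra.Polynomial"
begin

text \<open>This is the fibration theorem of Ehresmann for the map \<open>f\<close> on a ball, proved by lifting
  paths in the base with an ordinary differential equation.

  Over \<open>0 < |\<eta>| \<le> d\<close>, with \<open>d\<close> an admissible level for the radius \<open>r\<close>, the fibers of \<open>f\<close> are
  smooth inside the ball of radius \<open>\<rho>\<^sub>0\<close> and transverse to every sphere of radius between \<open>r\<close>
  and \<open>\<rho>\<^sub>0\<close>. A motion of the value \<open>f\<close> along \<open>\<eta> \<mapsto> \<eta> e\<^sup>t\<^sup>w\<close>, and at the same time a change of
  the radius \<open>s\<close> of the ball within \<open>[r, \<rho>\<^sub>0]\<close>, can therefore be lifted to a motion of the
  points of the ball. To make the radius an ordinary parameter, the ball of radius \<open>s\<close> is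
  rescaled to the unit ball, and the family \<open>F (s, y) = f (s y)\<close> is considered there.

  The lift has an explicit formula that treats interior and boundary alike. Let \<open>J\<close> be the
  differential of \<open>F (s, -)\<close> at \<open>y\<close> and \<open>A = 1 - y y\<^sup>T\<close>. The velocity \<open>v = A J\<^sup>T (J A J\<^sup>T)\<^sup>-\<^sup>1
  \<tau>\<close> satisfies \<open>J v = \<tau>\<close>, and it is tangent to the unit sphere because \<open>A\<close> kills the normal
  direction there. The symmetric \<open>2 \<times> 2\<close> matrix \<open>J A J\<^sup>T\<close> is invertible in the interior of the
  ball when the fiber is smooth, and on the sphere when the fiber is also transverse to it;
  its determinant is \<open>gram\<close>, and \<open>gram_pos_of_transverse\<close> is the place where the hypotheses on
  \<open>f\<close> enter.

  The formula has a denominator that may tend to zero with \<open>\<eta>\<close>. The differential equation is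
  therefore solved for a globally Lipschitz field that agrees with the right one where \<open>gram \<ge>
  \<epsilon>\<close>. The modified field is a nonnegative multiple of the velocity, so along its solutions
  \<open>(s, F)\<close> still runs through the prescribed path, only more slowly, and the solution cannot
  leave the compact part of the total space over that path. For small \<open>\<epsilon>\<close> it is a solution of
  the original equation (\<open>lift_exists\<close>). Uniqueness of lifts makes the endpoint map
  independent of \<open>\<epsilon>\<close>, and a convergent sequence of initial data is compact and so admits one
  \<open>\<epsilon>\<close>; hence the endpoint map is continuous although the tubes are not compact
  (\<open>continuous_on_transport\<close>). Reversing the path inverts it.

  The conclusions are then formal. Local triviality near \<open>b\<close> comes from transport by \<open>w = Ln
  (u / b)\<close>, and the isomorphisms from transport by \<open>w = ln (\<delta>' / \<delta>)\<close> with a change of the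
  radius. An admissible level for \<open>r\<close> serves every larger radius up to \<open>\<rho>\<^sub>0\<close>, so two tubes are
  compared through a third one, with the larger radius and the smaller level. Surjectivity
  only requires one point with a small nonzero value: \<open>f\<close> vanishes at the origin, since
  otherwise the constant term would be a critical face function, and \<open>f\<close> is not identically
  zero near the origin, since mixed monomials are linearly independent there.\<close>

section \<open>Ordinary differential equations with Lipschitz right-hand side\<close>

text \<open>Picard iteration in exponentially weighted coordinates \<open>\<gamma> t = e\<^sup>2\<^sup>K\<^sup>t h t\<close>: the weight turns
  the integral operator into a contraction by \<open>1/2\<close> on the whole unit interval, so no short
  time steps have to be glued. The clamp \<open>c\<close> extends functions on the unit interval to bounded
  continuous functions on the line, a complete space.\<close>

lemma lipschitz_ode_solution:
  fixes X :: "'a::euclidean_space \<Rightarrow> 'a" and x\<^sub>0 :: 'a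
  assumes "L-lipschitz_on UNIV X"
  obtains \<gamma> where "\<gamma> 0 = x\<^sub>0"
    "\<And>t. t \<in> {0..1} \<Longrightarrow> (\<gamma> has_vector_derivative X (\<gamma> t)) (at t within {0..1})"
proof -
  define K where "K = L + 1"
  have K: "K > 0" using lipschitz_on_nonneg[OF assms] by (simp add: K_def)
  have lip: "norm (X u - X v) \<le> K * norm (u - v)" for u v
    using lipschitz_on_normD[OF assms, of u v] lipschitz_on_nonneg[OF assms]
    by (simp add: K_def algebra_simps) (smt (verit) norm_ge_zero)
  have contX: "continuous_on UNIV X"
    using assms by (rule lipschitz_on_continuous_on)
  define c where "c t = max 0 (min 1 t)" for t :: real
  have c01: "c t \<in> {0..1}" for t by (simp add: c_def)
  have cc: "continuous_on UNIV c" unfolding c_def by (intro continuous_intros)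
  define J where "J h u = integral {0..u} (\<lambda>s. X (exp (2 * K * s) *\<^sub>R apply_bcontfun h s))"
    for h :: "real \<Rightarrow>\<^sub>C 'a" and u :: real
  have cont: "continuous_on S (\<lambda>s. X (exp (2 * K * s) *\<^sub>R apply_bcontfun h s))"
    for h :: "real \<Rightarrow>\<^sub>C 'a" and S :: "real set"
    by (rule continuous_on_compose2[OF contX]) (auto intro!: continuous_intros)
  define T where "T h t = exp (-(2*K*c t)) *\<^sub>R (x\<^sub>0 + J h (c t))" for h :: "real \<Rightarrow>\<^sub>C 'a" and t
  have contT1: "continuous_on {0..1} (\<lambda>u. exp (-(2*K*u)) *\<^sub>R (x\<^sub>0 + J h u))" for h
    unfolding J_def
    by (intro continuous_intros indefinite_integral_continuous_1 integrable_continuous_real cont)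
  have T_bcont: "T h \<in> bcontfun" for h
  proof -
    have "continuous_on UNIV (T h)"
      unfolding T_def by (rule continuous_on_compose2[OF contT1 cc]) (use c01 in auto)
    moreover have "bounded ((\<lambda>u. exp (-(2*K*u)) *\<^sub>R (x\<^sub>0 + J h u)) ` {0..1})"
      by (intro compact_imp_bounded compact_continuous_image contT1 compact_Icc)
    then have "bounded (range (T h))"
      by (rule bounded_subset) (use c01 in \<open>auto simp: T_def\<close>)
    ultimately show ?thesis by (simp add: bcontfun_def)
  qed
  have contr: "dist (Bcontfun (T h)) (Bcontfun (T k)) \<le> 1/2 * dist h k" for h k
  proof (rule dist_bound)
    fix t
    define u where "u = c t"
    have u: "0 \<le> u" "u \<le> 1" using c01[of t] by (auto simp: u_def)
    have e: "((\<lambda>s. K * exp (2 * K * s) * dist h k) has_integral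
        (exp (2*K*u) / 2 * dist h k - exp (2*K*0) / 2 * dist h k)) {0..u}"
      using K u by (intro fundamental_theorem_of_calculus)
        (auto intro!: derivative_eq_intros simp flip: has_real_derivative_iff_has_vector_derivative)
    have "J h u - J k u = integral {0..u} (\<lambda>s. X (exp (2 * K * s) *\<^sub>R h s) - X (exp (2 * K * s) *\<^sub>R k s))"
      unfolding J_def by (intro integral_diff[symmetric] integrable_continuous_real cont)
    also have "norm \<dots> \<le> integral {0..u} (\<lambda>s. K * exp (2 * K * s) * dist h k)"
    proof (rule integral_norm_bound_integral)
      fix s
      have "norm (X (exp (2 * K * s) *\<^sub>R h s) - X (exp (2 * K * s) *\<^sub>R k s))
          \<le> K * norm (exp (2 * K * s) *\<^sub>R h s - exp (2 * K * s) *\<^sub>R k s)" by (rule lip)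
      also have "\<dots> = K * exp (2 * K * s) * dist (h s) (k s)"
        by (simp add: dist_norm flip: scaleR_diff_right)
      also have "\<dots> \<le> K * exp (2 * K * s) * dist h k"
        using K by (intro mult_left_mono dist_bounded) auto
      finally show "norm (X (exp (2 * K * s) *\<^sub>R h s) - X (exp (2 * K * s) *\<^sub>R k s))
        \<le> K * exp (2 * K * s) * dist h k" .
    qed (use e in \<open>auto intro!: integrable_continuous_real cont continuous_intros\<close>)
    also have "\<dots> = exp (2*K*u) / 2 * dist h k - 1 / 2 * dist h k"
      using integral_unique[OF e] by simp
    also have "\<dots> \<le> exp (2*K*u) / 2 * dist h k" by simp
    finally have J: "norm (J h u - J k u) \<le> exp (2*K*u) / 2 * dist h k" .
    have "dist (T h t) (T k t) = exp (-(2*K*u)) * norm (J h u - J k u)"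
      by (simp add: T_def dist_norm u_def flip: scaleR_diff_right)
    also have "\<dots> \<le> exp (-(2*K*u)) * (exp (2*K*u) / 2 * dist h k)"
      by (intro mult_left_mono J) auto
    also have "\<dots> = 1/2 * dist h k" by (simp add: exp_minus)
    finally show "dist (apply_bcontfun (Bcontfun (T h)) t) (apply_bcontfun (Bcontfun (T k)) t)
        \<le> 1/2 * dist h k"
      by (simp add: Bcontfun_inverse T_bcont)
  qed
  obtain h where h: "Bcontfun (T h) = h"
    using banach_fix_type[of "1/2" "\<lambda>h. Bcontfun (T h)"] contr by auto
  have hT: "apply_bcontfun h t = T h t" for t
    using Bcontfun_inverse[OF T_bcont[of h]] h by simp
  define \<gamma> where "\<gamma> t = x\<^sub>0 + J h t" for t
  have g: "exp (2*K*t) *\<^sub>R apply_bcontfun h t = \<gamma> t" if "t \<in> {0..1}" for t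
    using that by (simp add: hT T_def c_def \<gamma>_def exp_minus)
  show ?thesis
  proof
    show "\<gamma> 0 = x\<^sub>0" by (simp add: \<gamma>_def J_def)
    fix t :: real assume t: "t \<in> {0..1}"
    show "(\<gamma> has_vector_derivative X (\<gamma> t)) (at t within {0..1})"
      using integral_has_vector_derivative[OF cont t, of h] unfolding g[OF t, symmetric]
      unfolding \<gamma>_def J_def by (auto intro!: derivative_eq_intros)
  qed
qed

text \<open>Gronwall: the squared distance, damped by \<open>e\<^sup>-\<^sup>2\<^sup>L\<^sup>t\<close>, does not increase. Used both for
  uniqueness and for continuous dependence on the initial value.\<close>

lemma ode_solutions_dist_le:
  fixes X :: "'a::euclidean_space \<Rightarrow> 'a"
  assumes lip: "L-lipschitz_on UNIV X"
    and a: "\<And>t. t \<in> {0..1} \<Longrightarrow> (\<alpha> has_vector_derivative X (\<alpha> t)) (at t within {0..1})"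
    and b: "\<And>t. t \<in> {0..1} \<Longrightarrow> (\<beta> has_vector_derivative X (\<beta> t)) (at t within {0..1})"
    and t: "t \<in> {0..1}"
  shows "norm (\<alpha> t - \<beta> t) \<le> exp L * norm (\<alpha> 0 - \<beta> 0)"
proof -
  define g where "g t = exp (-(2*L*t)) * (norm (\<alpha> t - \<beta> t))\<^sup>2" for t
  define g' where "g' t = exp (-(2*L*t)) * (2 * ((\<alpha> t - \<beta> t) \<bullet> (X (\<alpha> t) - X (\<beta> t))))
      - 2 * L * exp (-(2*L*t)) * (norm (\<alpha> t - \<beta> t))\<^sup>2" for t
  have L: "0 \<le> L" using lip by (rule lipschitz_on_nonneg)
  have der: "(g has_real_derivative g' u) (at u within {0..1})" if "u \<in> {0..1}" for u
    unfolding has_field_derivative_def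
    using a[OF that] b[OF that] unfolding g_def g'_def power2_norm_eq_inner has_vector_derivative_def
    by (auto intro!: derivative_eq_intros simp: fun_eq_iff algebra_simps inner_commute)
  have neg: "g' u \<le> 0" for u
  proof -
    have "(\<alpha> u - \<beta> u) \<bullet> (X (\<alpha> u) - X (\<beta> u)) \<le> norm (\<alpha> u - \<beta> u) * norm (X (\<alpha> u) - X (\<beta> u))"
      by (rule norm_cauchy_schwarz)
    also have "\<dots> \<le> norm (\<alpha> u - \<beta> u) * (L * norm (\<alpha> u - \<beta> u))"
      by (intro mult_left_mono lipschitz_on_normD[OF lip]) auto
    finally have "(\<alpha> u - \<beta> u) \<bullet> (X (\<alpha> u) - X (\<beta> u)) \<le> L * (norm (\<alpha> u - \<beta> u))\<^sup>2"
      by (simp add: power2_eq_square algebra_simps)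
    then have "exp (-(2*L*u)) * (2 * ((\<alpha> u - \<beta> u) \<bullet> (X (\<alpha> u) - X (\<beta> u))))
       \<le> exp (-(2*L*u)) * (2 * (L * (norm (\<alpha> u - \<beta> u))\<^sup>2))"
      by (intro mult_left_mono) auto
    then show ?thesis by (simp add: g'_def algebra_simps)
  qed
  have "g t \<le> g 0"
  proof (rule DERIV_nonpos_imp_decreasing_open[of 0 t g])
    show "0 \<le> t" using t by simp
    show "\<exists>y. (g has_real_derivative y) (at u) \<and> y \<le> 0" if "0 < u" "u < t" for u
      using der[of u] neg[of u] that t by (auto simp: at_within_Icc_at)
    have "continuous_on {0..1} g"
      using der by (rule DERIV_continuous_on)
    then show "continuous_on {0..t} g"
      by (rule continuous_on_subset) (use t in auto)
  qed
  then have "exp (-(2*L*t)) * (norm (\<alpha> t - \<beta> t))\<^sup>2 \<le> (norm (\<alpha> 0 - \<beta> 0))\<^sup>2"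
    by (simp add: g_def)
  then have "(norm (\<alpha> t - \<beta> t))\<^sup>2 \<le> exp (2*L*t) * (norm (\<alpha> 0 - \<beta> 0))\<^sup>2"
    by (simp add: exp_minus field_simps)
  also have "\<dots> \<le> exp (2*L) * (norm (\<alpha> 0 - \<beta> 0))\<^sup>2"
    using L t by (intro mult_right_mono) (auto simp: mult_left_le)
  also have "\<dots> = (exp L * norm (\<alpha> 0 - \<beta> 0))\<^sup>2"
    by (simp add: power_mult_distrib flip: exp_double)
  finally show ?thesis
    by (rule power2_le_imp_le) simp
qed

text \<open>All quantities that have to be followed along a solution (the value of \<open>F\<close>, the distance to
  the sphere) satisfy scalar linear equations, so they can be computed without knowing the
  solution.\<close>

lemma linear_ode_solution:
  fixes g :: "real \<Rightarrow> 'b::{banach, real_normed_field}"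
  assumes g: "\<And>t. t \<in> {0..1} \<Longrightarrow> (g has_vector_derivative a t * g t) (at t within {0..1})"
    and A: "\<And>t. t \<in> {0..1} \<Longrightarrow> (A has_vector_derivative a t) (at t within {0..1})"
    and t: "t \<in> {0..1}"
  shows "g t = g 0 * exp (A t - A 0)"
proof -
  have "((\<lambda>t. g t * exp (- A t)) has_vector_derivative 0) (at u within {0..1})"
    if u: "u \<in> {0..1}" for u
  proof -
    have "((\<lambda>x. exp (- x)) has_field_derivative - exp (- A u)) (at (A u) within A ` {0..1})"
      by (auto intro!: derivative_eq_intros)
    from field_vector_diff_chain_within[OF A[OF u] this]
    have "((\<lambda>t. exp (- A t)) has_vector_derivative a u * - exp (- A u)) (at u within {0..1})"
      by (simp add: o_def)
    from has_vector_derivative_mult[OF g[OF u] this] show ?thesis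
      by (simp add: algebra_simps)
  qed
  then obtain c where c: "\<And>t. t \<in> {0..1} \<Longrightarrow> g t * exp (- A t) = c"
    using has_vector_derivative_zero_constant[of "{0..1}" "\<lambda>t. g t * exp (- A t)"] by auto
  have "g t * exp (- A t) = g 0 * exp (- A 0)" using c[OF t] c[of 0] by simp
  then have "g t * exp (- A t) * exp (A t) = g 0 * exp (- A 0) * exp (A t)" by simp
  then show ?thesis
    by (simp add: exp_diff exp_minus field_simps)
qed

section \<open>Functions that are Lipschitz on every ball\<close>

text \<open>Unlike global Lipschitz continuity, this is stable under products, so all polynomial
  expressions have it.\<close>

definition ball_lipschitz :: "('a::real_normed_vector \<Rightarrow> 'b::real_normed_vector) \<Rightarrow> bool" where
  "ball_lipschitz f \<longleftrightarrow> (\<forall>R. \<exists>L. L-lipschitz_on (cball 0 R) f)"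

lemma ball_lipschitzI:
  assumes "\<And>R. \<exists>L. \<forall>x\<in>cball 0 R. \<forall>y\<in>cball 0 R. norm (f x - f y) \<le> L * norm (x - y)"
  shows "ball_lipschitz f"
  unfolding ball_lipschitz_def
proof
  fix R
  obtain L where L: "\<forall>x\<in>cball 0 R. \<forall>y\<in>cball 0 R. norm (f x - f y) \<le> L * norm (x - y)"
    using assms by blast
  have "\<bar>L\<bar>-lipschitz_on (cball 0 R) f"
    by (rule lipschitz_onI)
      (use L in \<open>auto simp: dist_norm intro: order_trans[OF _ mult_right_mono[OF abs_ge_self]]\<close>)
  then show "\<exists>L. L-lipschitz_on (cball 0 R) f" ..
qed

lemma ball_lipschitz_bounds:
  assumes "ball_lipschitz f"
  obtains B L where "0 \<le> B" "0 \<le> L" "\<And>x. norm x \<le> R \<Longrightarrow> norm (f x) \<le> B"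
    "\<And>x y. norm x \<le> R \<Longrightarrow> norm y \<le> R \<Longrightarrow> norm (f x - f y) \<le> L * norm (x - y)"
proof -
  obtain L where L: "L-lipschitz_on (cball 0 R) f"
    using assms by (auto simp: ball_lipschitz_def)
  have L0: "0 \<le> L" using L by (rule lipschitz_on_nonneg)
  have lip: "norm (f x - f y) \<le> L * norm (x - y)" if "norm x \<le> R" "norm y \<le> R" for x y
    using lipschitz_on_normD[OF L] that by simp
  have "norm (f x) \<le> norm (f 0) + L * \<bar>R\<bar>" if "norm x \<le> R" for x
  proof -
    have "norm (f x) \<le> norm (f 0) + norm (f x - f 0)"
      by (metis norm_triangle_sub)
    also have "norm (f x - f 0) \<le> L * norm (x - 0)"
      using that order_trans[OF norm_ge_zero[of x] that] by (intro lip) auto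
    also have "\<dots> \<le> L * \<bar>R\<bar>" using that L0 by (intro mult_left_mono) auto
    finally show ?thesis by simp
  qed
  then show ?thesis using L0 lip by (intro that[of "norm (f 0) + L * \<bar>R\<bar>" L]) auto
qed

lemma ball_lipschitz_continuous:
  assumes "ball_lipschitz f"
  shows "continuous_on S f"
proof (rule continuous_on_subset[OF _ subset_UNIV])
  have "isCont f x" for x
  proof -
    obtain L where "L-lipschitz_on (cball 0 (norm x + 1)) f"
      using assms by (auto simp: ball_lipschitz_def)
    then have "continuous_on (cball 0 (norm x + 1)) f"
      by (rule lipschitz_on_continuous_on)
    then show ?thesis
      by (rule continuous_on_interior) (auto intro!: interiorI[of "ball 0 (norm x + 1)"])
  qed
  then show "continuous_on UNIV f" by (simp add: continuous_at_imp_continuous_on)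
qed

lemma ball_lipschitz_const [intro]: "ball_lipschitz (\<lambda>x. c)"
  by (auto simp: ball_lipschitz_def intro: lipschitz_on_constant)

lemma ball_lipschitz_linear:
  assumes "bounded_linear f" shows "ball_lipschitz f"
proof -
  obtain K where K: "\<And>x. norm (f x) \<le> norm x * K"
    using bounded_linear.bounded[OF assms] by blast
  show ?thesis
    by (rule ball_lipschitzI)
      (metis K assms linear_diff bounded_linear.linear mult.commute)
qed

lemma ball_lipschitz_add [intro]:
  "ball_lipschitz f \<Longrightarrow> ball_lipschitz g \<Longrightarrow> ball_lipschitz (\<lambda>x. f x + g x)"
  unfolding ball_lipschitz_def by (blast intro: lipschitz_on_add)

lemma ball_lipschitz_diff [intro]:
  "ball_lipschitz f \<Longrightarrow> ball_lipschitz g \<Longrightarrow> ball_lipschitz (\<lambda>x. f x - g x)"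
  unfolding ball_lipschitz_def by (blast intro: lipschitz_on_diff)

lemma ball_lipschitz_Pair [intro]:
  "ball_lipschitz f \<Longrightarrow> ball_lipschitz g \<Longrightarrow> ball_lipschitz (\<lambda>x. (f x, g x))"
  unfolding ball_lipschitz_def by (blast intro: lipschitz_on_Pair)

lemma ball_lipschitz_sum [intro]:
  "(\<And>i. i \<in> I \<Longrightarrow> ball_lipschitz (f i)) \<Longrightarrow> ball_lipschitz (\<lambda>x. \<Sum>i\<in>I. f i x)"
  by (induction I rule: infinite_finite_induct) auto

lemma (in bounded_bilinear) ball_lipschitz:
  assumes f: "ball_lipschitz f" and g: "ball_lipschitz g"
  shows "ball_lipschitz (\<lambda>x. prod (f x) (g x))"
proof (rule ball_lipschitzI)
  fix R
  obtain K where K: "0 < K" "\<And>a b. norm (prod a b) \<le> norm a * norm b * K"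
    using pos_bounded by blast
  obtain B L where f: "0 \<le> B" "0 \<le> L" "\<And>x. norm x \<le> R \<Longrightarrow> norm (f x) \<le> B"
    "\<And>x y. norm x \<le> R \<Longrightarrow> norm y \<le> R \<Longrightarrow> norm (f x - f y) \<le> L * norm (x - y)"
    using ball_lipschitz_bounds[OF f, of R] by metis
  obtain C M where g: "0 \<le> C" "0 \<le> M" "\<And>x. norm x \<le> R \<Longrightarrow> norm (g x) \<le> C"
    "\<And>x y. norm x \<le> R \<Longrightarrow> norm y \<le> R \<Longrightarrow> norm (g x - g y) \<le> M * norm (x - y)"
    using ball_lipschitz_bounds[OF g, of R] by metis
  have "norm (prod (f x) (g x) - prod (f y) (g y)) \<le> (B * M * K + L * C * K) * norm (x - y)"
    if "norm x \<le> R" "norm y \<le> R" for x y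
  proof -
    have "prod (f x) (g x) - prod (f y) (g y) = prod (f x) (g x - g y) + prod (f x - f y) (g y)"
      by (simp add: diff_left diff_right)
    also have "norm \<dots> \<le> norm (f x) * norm (g x - g y) * K + norm (f x - f y) * norm (g y) * K"
      by (intro order_trans[OF norm_triangle_ineq] add_mono K)
    also have "\<dots> \<le> B * (M * norm (x - y)) * K + (L * norm (x - y)) * C * K"
      using that K(1) f g by (intro add_mono mult_right_mono mult_mono) auto
    finally show ?thesis by (simp add: algebra_simps)
  qed
  then show "\<exists>L. \<forall>x\<in>cball 0 R. \<forall>y\<in>cball 0 R.
      norm (prod (f x) (g x) - prod (f y) (g y)) \<le> L * norm (x - y)"
    by (intro exI[of _ "B * M * K + L * C * K"]) auto
qed

lemmas ball_lipschitz_mult [intro] = bounded_bilinear.ball_lipschitz[OF bounded_bilinear_mult]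
lemmas ball_lipschitz_scaleR [intro] = bounded_bilinear.ball_lipschitz[OF bounded_bilinear_scaleR]
lemmas ball_lipschitz_inner [intro] = bounded_bilinear.ball_lipschitz[OF bounded_bilinear_inner]

lemma ball_lipschitz_compose:
  assumes g: "ball_lipschitz g" and f: "ball_lipschitz f"
  shows "ball_lipschitz (\<lambda>x. g (f x))"
proof (rule ball_lipschitzI)
  fix R
  obtain B L where f: "0 \<le> B" "0 \<le> L" "\<And>x. norm x \<le> R \<Longrightarrow> norm (f x) \<le> B"
    "\<And>x y. norm x \<le> R \<Longrightarrow> norm y \<le> R \<Longrightarrow> norm (f x - f y) \<le> L * norm (x - y)"
    using ball_lipschitz_bounds[OF f, of R] by metis
  obtain M where g: "0 \<le> M"
    "\<And>x y. norm x \<le> B \<Longrightarrow> norm y \<le> B \<Longrightarrow> norm (g x - g y) \<le> M * norm (x - y)"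
    using ball_lipschitz_bounds[OF g, of B] by metis
  have "norm (g (f x) - g (f y)) \<le> M * L * norm (x - y)" if "norm x \<le> R" "norm y \<le> R" for x y
    using g(2)[OF f(3)[OF that(1)] f(3)[OF that(2)]] mult_left_mono[OF f(4)[OF that] g(1)]
    by (simp add: mult.assoc)
  then show "\<exists>L. \<forall>x\<in>cball 0 R. \<forall>y\<in>cball 0 R. norm (g (f x) - g (f y)) \<le> L * norm (x - y)"
    by (intro exI[of _ "M * L"]) auto
qed

lemma ball_lipschitz_inverse_max:
  fixes f :: "'a::real_normed_vector \<Rightarrow> real"
  assumes "\<epsilon> > 0" and f: "ball_lipschitz f"
  shows "ball_lipschitz (\<lambda>x. inverse (max (f x) \<epsilon>))"
proof (rule ball_lipschitz_compose[OF _ f, of "\<lambda>t. inverse (max t \<epsilon>)"])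
  have "\<bar>inverse (max s \<epsilon>) - inverse (max t \<epsilon>)\<bar> \<le> inverse (\<epsilon>\<^sup>2) * \<bar>s - t\<bar>" for s t
  proof -
    define a where "a = max s \<epsilon>"
    define b where "b = max t \<epsilon>"
    have ab: "a \<ge> \<epsilon>" "b \<ge> \<epsilon>" "\<bar>a - b\<bar> \<le> \<bar>s - t\<bar>" by (auto simp: a_def b_def)
    then have pos: "a > 0" "b > 0" using assms by auto
    have "inverse a - inverse b = inverse (a * b) * (b - a)"
      using pos by (simp add: field_simps)
    then have "\<bar>inverse a - inverse b\<bar> = inverse (a * b) * \<bar>a - b\<bar>"
      using pos by (simp add: abs_mult)
    also have "\<dots> \<le> inverse (\<epsilon>\<^sup>2) * \<bar>s - t\<bar>"
      using ab pos assms unfolding power2_eq_square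
      by (intro mult_mono le_imp_inverse_le) auto
    finally show ?thesis by (simp add: a_def b_def)
  qed
  then show "ball_lipschitz (\<lambda>t. inverse (max t \<epsilon>))"
    by (intro ball_lipschitzI exI[of _ "inverse (\<epsilon>\<^sup>2)"]) auto
qed

definition cutoff :: "real \<Rightarrow> 'a::real_normed_vector \<Rightarrow> real" where
  "cutoff R x = max 0 (min 1 (R + 1 - norm x))"

lemma cutoff_nonneg: "0 \<le> cutoff R x" and cutoff_le_one: "cutoff R x \<le> 1"
  and cutoff_eq_one: "norm x \<le> R \<Longrightarrow> cutoff R x = 1"
  by (auto simp: cutoff_def)

lemma cutoff_lipschitz: "\<bar>cutoff R x - cutoff R y\<bar> \<le> norm (x - y)"
  using norm_triangle_ineq3[of x y] by (auto simp: cutoff_def)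

text \<open>Multiplication by a cutoff makes such a function globally Lipschitz without changing it on
  the ball of radius \<open>R\<close>.\<close>

lemma lipschitz_cutoff_scaleR:
  assumes "ball_lipschitz f"
  obtains L where "L-lipschitz_on UNIV (\<lambda>x. cutoff R x *\<^sub>R f x)"
proof -
  obtain B L where f: "0 \<le> B" "0 \<le> L" "\<And>x. norm x \<le> R + 1 \<Longrightarrow> norm (f x) \<le> B"
    "\<And>x y. norm x \<le> R + 1 \<Longrightarrow> norm y \<le> R + 1 \<Longrightarrow> norm (f x - f y) \<le> L * norm (x - y)"
    using ball_lipschitz_bounds[OF assms, of "R + 1"] by metis
  have out: "cutoff R x = 0" if "\<not> norm x \<le> R + 1" for x :: 'a
    using that by (auto simp: cutoff_def)
  have one: "norm (cutoff R x *\<^sub>R f x - cutoff R y *\<^sub>R f y) \<le> (B + L) * norm (x - y)"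
    if x: "norm x \<le> R + 1" for x y
  proof (cases "norm y \<le> R + 1")
    case True
    have "cutoff R x *\<^sub>R f x - cutoff R y *\<^sub>R f y =
        (cutoff R x - cutoff R y) *\<^sub>R f x + cutoff R y *\<^sub>R (f x - f y)"
      by (simp add: algebra_simps)
    also have "norm \<dots> \<le> \<bar>cutoff R x - cutoff R y\<bar> * norm (f x) + cutoff R y * norm (f x - f y)"
      by (rule order_trans[OF norm_triangle_ineq]) (simp add: cutoff_nonneg)
    also have "\<dots> \<le> norm (x - y) * B + 1 * (L * norm (x - y))"
      using f x True by (intro add_mono mult_mono cutoff_lipschitz cutoff_le_one) auto
    finally show ?thesis by (simp add: algebra_simps)
  next
    case False
    then have "norm (cutoff R x *\<^sub>R f x - cutoff R y *\<^sub>R f y) = \<bar>cutoff R x - cutoff R y\<bar> * norm (f x)"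
      by (simp add: out)
    also have "\<dots> \<le> norm (x - y) * B"
      using f x by (intro mult_mono cutoff_lipschitz) auto
    also have "\<dots> \<le> (B + L) * norm (x - y)" using f by (simp add: algebra_simps)
    finally show ?thesis .
  qed
  have "norm (cutoff R x *\<^sub>R f x - cutoff R y *\<^sub>R f y) \<le> (B + L) * norm (x - y)" for x y
    using one[of x y] one[of y x] f(1,2) out[of x] out[of y]
    by (cases "norm x \<le> R + 1"; cases "norm y \<le> R + 1") (auto simp: norm_minus_commute)
  then have "(B + L)-lipschitz_on UNIV (\<lambda>x. cutoff R x *\<^sub>R f x)"
    using f by (intro lipschitz_onI) (auto simp: dist_norm)
  then show ?thesis by (rule that)
qed

text \<open>Differentiability with a locally Lipschitz derivative, which is what a vector field built
  from first derivatives has to inherit.\<close>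

definition lipschitz_diff ::
    "('a::real_normed_vector \<Rightarrow> 'b::real_normed_vector) \<Rightarrow> ('a \<Rightarrow> 'a \<Rightarrow> 'b) \<Rightarrow> bool" where
  "lipschitz_diff F F' \<longleftrightarrow> (\<forall>x. (F has_derivative F' x) (at x)) \<and> ball_lipschitz F \<and>
     (\<forall>v. ball_lipschitz (\<lambda>x. F' x v))"

lemma lipschitz_diff_const: "\<exists>F'. lipschitz_diff (\<lambda>x. c) F'"
  by (rule exI[of _ "\<lambda>x v. 0"]) (auto simp: lipschitz_diff_def)

lemma lipschitz_diff_linear: "bounded_linear f \<Longrightarrow> \<exists>F'. lipschitz_diff f F'"
  by (rule exI[of _ "\<lambda>x. f"])
    (auto simp: lipschitz_diff_def ball_lipschitz_linear bounded_linear_imp_has_derivative)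

lemma lipschitz_diff_add:
  assumes "\<exists>F'. lipschitz_diff f F'" "\<exists>F'. lipschitz_diff g F'"
  shows "\<exists>F'. lipschitz_diff (\<lambda>x. f x + g x) F'"
proof -
  from assms obtain f' g' where "lipschitz_diff f f'" "lipschitz_diff g g'" by blast
  then have "lipschitz_diff (\<lambda>x. f x + g x) (\<lambda>x v. f' x v + g' x v)"
    unfolding lipschitz_diff_def by (auto intro!: has_derivative_add)
  then show ?thesis by blast
qed

lemma lipschitz_diff_mult:
  fixes f g :: "'a::real_normed_vector \<Rightarrow> 'b::real_normed_algebra"
  assumes "\<exists>F'. lipschitz_diff f F'" "\<exists>F'. lipschitz_diff g F'"
  shows "\<exists>F'. lipschitz_diff (\<lambda>x. f x * g x) F'"
proof -
  from assms obtain f' g' where "lipschitz_diff f f'" "lipschitz_diff g g'" by blast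
  then have "lipschitz_diff (\<lambda>x. f x * g x) (\<lambda>x v. f x * g' x v + f' x v * g x)"
    unfolding lipschitz_diff_def
    by (intro conjI allI has_derivative_mult ball_lipschitz_add ball_lipschitz_mult) auto
  then show ?thesis by blast
qed

lemma lipschitz_diff_power:
  fixes f :: "'a::real_normed_vector \<Rightarrow> 'b::real_normed_algebra_1"
  shows "\<exists>F'. lipschitz_diff f F' \<Longrightarrow> \<exists>F'. lipschitz_diff (\<lambda>x. f x ^ n) F'"
  by (induction n) (auto intro!: lipschitz_diff_const lipschitz_diff_mult)

lemma lipschitz_diff_sum:
  "(\<And>i. i \<in> I \<Longrightarrow> \<exists>F'. lipschitz_diff (f i) F') \<Longrightarrow> \<exists>F'. lipschitz_diff (\<lambda>x. \<Sum>i\<in>I. f i x) F'"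
  by (induction I rule: infinite_finite_induct) (auto intro!: lipschitz_diff_const lipschitz_diff_add)

lemma lipschitz_diff_prod:
  fixes f :: "'i \<Rightarrow> 'a::real_normed_vector \<Rightarrow> 'b::{real_normed_algebra_1, comm_ring_1}"
  shows "(\<And>i. i \<in> I \<Longrightarrow> \<exists>F'. lipschitz_diff (f i) F') \<Longrightarrow>
    \<exists>F'. lipschitz_diff (\<lambda>x. \<Prod>i\<in>I. f i x) F'"
  by (induction I rule: infinite_finite_induct) (auto intro!: lipschitz_diff_const lipschitz_diff_mult)

section \<open>Lifting velocities over a family of maps on the unit ball\<close>

text \<open>At the columns of its adjugate matrix the form takes the values \<open>d\<close> and \<open>a\<close> times the
  determinant.\<close>

lemma binary_form_det:
  fixes a b d :: real
  assumes "\<And>\<alpha> \<beta>. 0 \<le> a * \<alpha>\<^sup>2 + 2 * b * \<alpha> * \<beta> + d * \<beta>\<^sup>2"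
  shows "0 \<le> a * d - b\<^sup>2"
    and "a * d - b\<^sup>2 = 0 \<Longrightarrow> \<exists>\<alpha> \<beta>. (\<alpha>, \<beta>) \<noteq> (0, 0) \<and> a * \<alpha>\<^sup>2 + 2 * b * \<alpha> * \<beta> + d * \<beta>\<^sup>2 = 0"
proof -
  have a: "0 \<le> a" using assms[of 1 0] by simp
  have d: "0 \<le> d" using assms[of 0 1] by simp
  have 1: "0 \<le> a * (a * d - b\<^sup>2)" using assms[of "-b" a] by (simp add: power2_eq_square algebra_simps)
  have 2: "0 \<le> d * (a * d - b\<^sup>2)" using assms[of d "-b"] by (simp add: power2_eq_square algebra_simps)
  show "0 \<le> a * d - b\<^sup>2"
  proof (rule ccontr)
    assume neg: "\<not> 0 \<le> a * d - b\<^sup>2"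
    then have "a = 0" "d = 0" using a d 1 2 by (auto simp only: zero_le_mult_iff not_le)
    then have "b\<^sup>2 \<le> 0" using assms[of 1 "-b"] \<open>a = 0\<close> \<open>d = 0\<close> by (simp add: power2_eq_square)
    then show False using neg \<open>a = 0\<close> by simp
  qed
  assume 0: "a * d - b\<^sup>2 = 0"
  show "\<exists>\<alpha> \<beta>. (\<alpha>, \<beta>) \<noteq> (0, 0) \<and> a * \<alpha>\<^sup>2 + 2 * b * \<alpha> * \<beta> + d * \<beta>\<^sup>2 = 0"
  proof (cases "a = 0")
    case True
    then show ?thesis by (intro exI[of _ 1] exI[of _ 0]) simp
  next
    case False
    have "a * (-b)\<^sup>2 + 2 * b * (-b) * a + d * a\<^sup>2 = a * (a * d - b\<^sup>2)"
      by (simp add: power2_eq_square algebra_simps)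
    then show ?thesis using False 0 by (intro exI[of _ "-b"] exI[of _ a]) simp
  qed
qed

text \<open>The first component is the parameter of the family. The second one is to run through the
  unit ball, but \<open>F\<close> is given on the whole space, so that no one-sided derivatives occur on
  the sphere.\<close>

locale ball_family =
  fixes F :: "real \<times> 'a::euclidean_space \<Rightarrow> complex"
    and F' :: "real \<times> 'a \<Rightarrow> real \<times> 'a \<Rightarrow> complex"
  assumes F: "lipschitz_diff F F'"
begin

lemma F_derivative: "(F has_derivative F' x) (at x)"
  and F_ball_lipschitz: "ball_lipschitz F"
  and F'_ball_lipschitz: "ball_lipschitz (\<lambda>x. F' x v)"
  using F unfolding lipschitz_diff_def by blast+

lemma F'_linear: "linear (F' x)"
  using F_derivative has_derivative_linear by blast

text \<open>\<open>J\<^sup>T m\<close>, where \<open>J\<close> is the differential in the direction of the ball.\<close>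

definition grad :: "complex \<Rightarrow> real \<times> 'a \<Rightarrow> 'a" where
  "grad m x = (\<Sum>b\<in>Basis. (m \<bullet> F' x (0, b)) *\<^sub>R b)"

lemma grad_inner: "grad m x \<bullet> v = m \<bullet> F' x (0, v)"
proof -
  have lin: "linear (\<lambda>v. m \<bullet> F' x (0, v))"
  proof (rule linearI)
    fix u v show "m \<bullet> F' x (0, u + v) = m \<bullet> F' x (0, u) + m \<bullet> F' x (0, v)"
      using linear_add[OF F'_linear, of x "(0, u)" "(0, v)"] by (simp add: inner_add_right)
  next
    fix r v show "m \<bullet> F' x (0, r *\<^sub>R v) = r *\<^sub>R (m \<bullet> F' x (0, v))"
      using linear_scale[OF F'_linear, of x r "(0, v)"] by simp
  qed
  have "m \<bullet> F' x (0, v) = (\<lambda>v. m \<bullet> F' x (0, v)) (\<Sum>b\<in>Basis. (v \<bullet> b) *\<^sub>R b)"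
    by (simp add: euclidean_representation)
  also have "\<dots> = (\<Sum>b\<in>Basis. (v \<bullet> b) * (m \<bullet> F' x (0, b)))"
    by (subst linear_sum[OF lin]) (simp add: linear_scale[OF lin])
  also have "\<dots> = grad m x \<bullet> v"
    by (simp add: grad_def inner_sum_left inner_commute[of v] mult.commute)
  finally show ?thesis by simp
qed

lemma grad_combination: "grad (a *\<^sub>R m + b *\<^sub>R n) x = a *\<^sub>R grad m x + b *\<^sub>R grad n x"
  by (rule euclidean_eqI) (simp add: grad_inner inner_add_left)

text \<open>The operator \<open>A = 1 - y y\<^sup>T\<close>: positive definite inside the unit ball, and the orthogonal
  projection to the tangent space on the unit sphere.\<close>

definition tangential :: "real \<times> 'a \<Rightarrow> 'a \<Rightarrow> 'a" where
  "tangential x u = u - (u \<bullet> snd x) *\<^sub>R snd x"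

text \<open>The bilinear form of the matrix \<open>J A J\<^sup>T\<close>.\<close>

definition quad :: "real \<times> 'a \<Rightarrow> complex \<Rightarrow> complex \<Rightarrow> real" where
  "quad x m n = grad m x \<bullet> tangential x (grad n x)"

lemma quad_eq: "quad x m n = grad m x \<bullet> grad n x - (grad m x \<bullet> snd x) * (grad n x \<bullet> snd x)"
  by (simp add: quad_def tangential_def inner_diff_right)

definition gram :: "real \<times> 'a \<Rightarrow> real" where
  "gram x = quad x 1 1 * quad x \<i> \<i> - (quad x 1 \<i>)\<^sup>2"

text \<open>The adjugate of \<open>J A J\<^sup>T\<close>, applied to \<open>\<tau>\<close>. The adjugate is used in place of the inverse to
  keep everything polynomial in the derivatives of \<open>F\<close>.\<close>

definition cramer :: "real \<times> 'a \<Rightarrow> complex \<Rightarrow> complex" where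
  "cramer x \<tau> = (quad x \<i> \<i> * Re \<tau> - quad x 1 \<i> * Im \<tau>) *\<^sub>R 1
     + (quad x 1 1 * Im \<tau> - quad x 1 \<i> * Re \<tau>) *\<^sub>R \<i>"

lemma F'_tangential_cramer:
  "F' x (0, tangential x (grad (cramer x \<tau>) x)) = gram x *\<^sub>R \<tau>"
proof -
  have sym: "quad x \<i> 1 = quad x 1 \<i>" by (simp add: quad_eq inner_commute mult.commute)
  have lin: "quad x m (a *\<^sub>R 1 + b *\<^sub>R \<i>) = a * quad x m 1 + b * quad x m \<i>" for m a b
    unfolding quad_eq grad_combination by (simp add: inner_add_left inner_add_right algebra_simps)
  have "m \<bullet> F' x (0, tangential x (grad (cramer x \<tau>) x)) = quad x m (cramer x \<tau>)" for m
    by (simp add: grad_inner quad_def)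
  from this[of 1] this[of \<i>] show ?thesis
    unfolding cramer_def lin sym gram_def
    by (intro complex_eqI) (simp_all add: inner_complex_def power2_eq_square algebra_simps)
qed

lemma quad_nonneg:
  assumes "norm (snd x) \<le> 1"
  shows "0 \<le> quad x m m"
proof -
  have "\<bar>grad m x \<bullet> snd x\<bar> \<le> norm (grad m x) * norm (snd x)" by (rule Cauchy_Schwarz_ineq2)
  also have "\<dots> \<le> norm (grad m x)" using assms by (simp add: mult_left_le)
  finally have "(grad m x \<bullet> snd x)\<^sup>2 \<le> (norm (grad m x))\<^sup>2"
    by (metis abs_norm_cancel abs_le_square_iff)
  then show ?thesis by (simp add: quad_eq power2_norm_eq_inner) (simp add: power2_eq_square)
qed

lemma quad_expand:
  "quad x (\<alpha> *\<^sub>R 1 + \<beta> *\<^sub>R \<i>) (\<alpha> *\<^sub>R 1 + \<beta> *\<^sub>R \<i>)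
    = quad x 1 1 * \<alpha>\<^sup>2 + 2 * quad x 1 \<i> * \<alpha> * \<beta> + quad x \<i> \<i> * \<beta>\<^sup>2"
  unfolding quad_eq grad_combination
  by (simp add: inner_add_left inner_add_right inner_commute power2_eq_square algebra_simps)

lemma gram_nonneg:
  assumes "norm (snd x) \<le> 1"
  shows "0 \<le> gram x"
  unfolding gram_def
  by (rule binary_form_det(1), subst quad_expand[symmetric]) (rule quad_nonneg[OF assms])

text \<open>If \<open>J A J\<^sup>T\<close> is degenerate, some \<open>u = J\<^sup>T m\<close> with \<open>m \<noteq> 0\<close> satisfies \<open>u \<bullet> A u = 0\<close>. As \<open>0 \<le> A
  \<le> 1\<close>, this forces \<open>A u = 0\<close>.\<close>

lemma gram_pos:
  assumes x: "norm (snd x) \<le> 1"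
    and indep: "\<And>m. tangential x (grad m x) = 0 \<Longrightarrow> m = 0"
  shows "0 < gram x"
proof (rule ccontr)
  assume "\<not> 0 < gram x"
  then have "gram x = 0" using gram_nonneg[OF x] by simp
  then obtain \<alpha> \<beta> where nz: "(\<alpha>, \<beta>) \<noteq> (0, 0)"
    and z: "quad x 1 1 * \<alpha>\<^sup>2 + 2 * quad x 1 \<i> * \<alpha> * \<beta> + quad x \<i> \<i> * \<beta>\<^sup>2 = 0"
    using binary_form_det(2)[of "quad x 1 1" "quad x 1 \<i>" "quad x \<i> \<i>"] quad_nonneg[OF x]
      quad_expand[of x] unfolding gram_def by metis
  define m where "m = \<alpha> *\<^sub>R 1 + \<beta> *\<^sub>R \<i>"
  have "m \<noteq> 0" using nz by (auto simp: m_def complex_eq_iff)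
  define u where "u = grad m x"
  define y where "y = snd x"
  have q: "u \<bullet> u = (u \<bullet> y)\<^sup>2"
    using z unfolding quad_expand[symmetric] by (simp add: quad_eq m_def u_def y_def power2_eq_square)
  have "(norm (tangential x u))\<^sup>2 = u \<bullet> u - 2 * (u \<bullet> y)\<^sup>2 + (u \<bullet> y)\<^sup>2 * (norm y)\<^sup>2"
    unfolding power2_norm_eq_inner
    by (simp add: tangential_def y_def inner_diff_left inner_diff_right inner_commute
      power2_eq_square algebra_simps)
  also have "\<dots> = (u \<bullet> y)\<^sup>2 * ((norm y)\<^sup>2 - 1)" using q by (simp add: algebra_simps)
  also have "\<dots> \<le> 0"
    using x by (intro mult_nonneg_nonpos) (auto simp: y_def power_le_one)
  finally have "tangential x u = 0" by simp
  then show False using indep[of m] \<open>m \<noteq> 0\<close> by (simp add: u_def)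
qed

text \<open>The lift, multiplied by the determinant \<open>gram x\<close>, of the infinitesimal motion \<open>k = (w, c)\<close>
  that moves the parameter with speed \<open>c\<close> and the value of \<open>F\<close> with speed \<open>w F\<close>.\<close>

definition velocity :: "complex \<times> real \<Rightarrow> real \<times> 'a \<Rightarrow> real \<times> 'a" where
  "velocity k x = (snd k * gram x,
     tangential x (grad (cramer x (fst k * F x - snd k *\<^sub>R F' x (1, 0))) x))"

lemma F'_velocity: "F' x (velocity k x) = gram x *\<^sub>R (fst k * F x)"
proof -
  define \<tau> where "\<tau> = fst k * F x - snd k *\<^sub>R F' x (1, 0)"
  have "velocity k x = (snd k * gram x) *\<^sub>R (1, 0) + (0, tangential x (grad (cramer x \<tau>) x))"
    by (simp add: velocity_def \<tau>_def)
  then have "F' x (velocity k x) = (snd k * gram x) *\<^sub>R F' x (1, 0) + gram x *\<^sub>R \<tau>"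
    by (simp only: linear_add[OF F'_linear] linear_scale[OF F'_linear] F'_tangential_cramer)
  then show ?thesis by (simp add: \<tau>_def algebra_simps)
qed

lemma velocity_minus: "velocity (- k) x = - velocity k x"
proof -
  have "cramer x (- \<tau>) = (-1) *\<^sub>R cramer x \<tau> + 0 *\<^sub>R 0" for \<tau>
    by (simp add: cramer_def algebra_simps)
  then have "grad (cramer x (- \<tau>)) x = - grad (cramer x \<tau>) x" for \<tau>
    by (simp only: grad_combination) simp
  moreover have "fst (- k) * F x - snd (- k) *\<^sub>R F' x (1, 0)
      = - (fst k * F x - snd k *\<^sub>R F' x (1, 0))" by simp
  ultimately show ?thesis
    unfolding velocity_def by (simp only:) (simp add: tangential_def)
qed

text \<open>The radial speed of a lifted motion is a multiple of \<open>1 - |y|\<^sup>2\<close>, so the unit ball is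
  invariant.\<close>

lemma inner_tangential: "snd x \<bullet> tangential x u = (1 - (norm (snd x))\<^sup>2) * (u \<bullet> snd x)"
  by (simp add: tangential_def inner_diff_right power2_norm_eq_inner inner_commute algebra_simps)

lemma ball_lipschitz_parts:
  shows ball_lipschitz_quad: "ball_lipschitz (\<lambda>x. quad x m n)"
    and ball_lipschitz_gram: "ball_lipschitz gram"
    and ball_lipschitz_velocity: "ball_lipschitz (\<lambda>p. velocity (fst p) (snd p))"
proof -
  have grad: "ball_lipschitz (\<lambda>x. grad m x)" for m
    unfolding grad_def by (intro ball_lipschitz_sum ball_lipschitz_scaleR ball_lipschitz_inner
        ball_lipschitz_const F'_ball_lipschitz)
  show quad: "ball_lipschitz (\<lambda>x. quad x m n)" for m n
    unfolding quad_eq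
    by (intro ball_lipschitz_diff ball_lipschitz_inner ball_lipschitz_mult grad
      ball_lipschitz_linear bounded_linear_snd)
  have "ball_lipschitz (\<lambda>x. gram x)"
    unfolding gram_def power2_eq_square
    by (intro ball_lipschitz_diff ball_lipschitz_mult quad)
  then show gram: "ball_lipschitz gram" by simp
  have snd: "ball_lipschitz (\<lambda>p::(complex \<times> real) \<times> real \<times> 'a. g (snd p))" if "ball_lipschitz g"
    for g :: "real \<times> 'a \<Rightarrow> 'c::real_normed_vector"
    by (rule ball_lipschitz_compose[OF that]) (intro ball_lipschitz_linear bounded_linear_snd)
  define \<tau> where "\<tau> p = fst (fst p) * F (snd p) - snd (fst p) *\<^sub>R F' (snd p) (1, 0)" for p
  have \<tau>: "ball_lipschitz \<tau>"
    unfolding \<tau>_def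
    by (intro ball_lipschitz_diff ball_lipschitz_mult ball_lipschitz_scaleR snd
      F_ball_lipschitz F'_ball_lipschitz ball_lipschitz_linear
      bounded_linear_fst_comp bounded_linear_snd_comp bounded_linear_fst)
  have re: "ball_lipschitz (\<lambda>p. Re (\<tau> p))" "ball_lipschitz (\<lambda>p. Im (\<tau> p))"
    by (rule ball_lipschitz_compose[OF ball_lipschitz_linear \<tau>],
      intro bounded_linear_Re bounded_linear_Im)+
  have cr: "ball_lipschitz (\<lambda>p. cramer (snd p) (\<tau> p))"
    unfolding cramer_def
    by (intro ball_lipschitz_add ball_lipschitz_scaleR ball_lipschitz_diff ball_lipschitz_mult
      re snd[OF quad] ball_lipschitz_const)
  have gc: "ball_lipschitz (\<lambda>p. grad (cramer (snd p) (\<tau> p)) (snd p))"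
    unfolding grad_def
    by (intro ball_lipschitz_sum ball_lipschitz_scaleR ball_lipschitz_inner cr
        ball_lipschitz_const snd[OF F'_ball_lipschitz])
  have y: "ball_lipschitz (\<lambda>p::(complex \<times> real) \<times> real \<times> 'a. snd (snd p))"
    by (rule snd) (intro ball_lipschitz_linear bounded_linear_snd)
  have "ball_lipschitz (\<lambda>p. (snd (fst p) * gram (snd p),
     tangential (snd p) (grad (cramer (snd p) (\<tau> p)) (snd p))))"
    unfolding tangential_def
    by (intro ball_lipschitz_Pair ball_lipschitz_diff ball_lipschitz_mult ball_lipschitz_scaleR
      ball_lipschitz_inner snd[OF gram] gc y ball_lipschitz_linear bounded_linear_snd_comp bounded_linear_fst)
  then show "ball_lipschitz (\<lambda>p. velocity (fst p) (snd p))"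
    by (simp add: velocity_def \<tau>_def)
qed

section \<open>Lifted paths\<close>

definition lift :: "complex \<times> real \<Rightarrow> (real \<Rightarrow> real \<times> 'a) \<Rightarrow> bool" where
  "lift k \<gamma> \<longleftrightarrow> (\<forall>t\<in>{0..1}. norm (snd (\<gamma> t)) \<le> 1 \<and> 0 < gram (\<gamma> t) \<and>
     (\<gamma> has_vector_derivative inverse (gram (\<gamma> t)) *\<^sub>R velocity k (\<gamma> t)) (at t within {0..1}))"

definition rate :: "real \<Rightarrow> real \<Rightarrow> (complex \<times> real) \<times> real \<times> 'a \<Rightarrow> real" where
  "rate R \<epsilon> p = cutoff R p * inverse (max (gram (snd p)) \<epsilon>)"

text \<open>The motion \<open>k\<close> is part of the state, with zero speed, so that continuous dependence on the
  initial value includes continuous dependence on \<open>k\<close>.\<close>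

definition flow_field ::
    "real \<Rightarrow> real \<Rightarrow> (complex \<times> real) \<times> real \<times> 'a \<Rightarrow> (complex \<times> real) \<times> real \<times> 'a" where
  "flow_field R \<epsilon> p = (0, rate R \<epsilon> p *\<^sub>R velocity (fst p) (snd p))"

lemma flow_field_lipschitz:
  assumes "\<epsilon> > 0"
  obtains L where "L-lipschitz_on UNIV (flow_field R \<epsilon>)"
proof -
  have "ball_lipschitz (\<lambda>p::(complex \<times> real) \<times> real \<times> 'a. gram (snd p))"
    by (rule ball_lipschitz_compose[OF ball_lipschitz_gram])
      (intro ball_lipschitz_linear bounded_linear_snd)
  then have "ball_lipschitz (\<lambda>p. (0 :: complex \<times> real,
      inverse (max (gram (snd p)) \<epsilon>) *\<^sub>R velocity (fst p) (snd p)))"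
    using assms by (intro ball_lipschitz_Pair ball_lipschitz_const ball_lipschitz_scaleR
      ball_lipschitz_inverse_max ball_lipschitz_velocity)
  then obtain L where "L-lipschitz_on UNIV (\<lambda>p. cutoff R p *\<^sub>R (0 :: complex \<times> real,
      inverse (max (gram (snd p)) \<epsilon>) *\<^sub>R velocity (fst p) (snd p)))"
    using lipschitz_cutoff_scaleR by blast
  then show ?thesis
    by (intro that[of L]) (simp add: flow_field_def[abs_def] rate_def)
qed

lemma lift_flow:
  assumes \<gamma>: "lift k \<gamma>" and t: "t \<in> {0..1}" and "0 < \<epsilon>" "\<epsilon> \<le> gram (\<gamma> t)" "norm (k, \<gamma> t) \<le> R"
  shows "((\<lambda>t. (k, \<gamma> t)) has_vector_derivative flow_field R \<epsilon> (k, \<gamma> t)) (at t within {0..1})"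
proof -
  have "(\<gamma> has_vector_derivative inverse (gram (\<gamma> t)) *\<^sub>R velocity k (\<gamma> t)) (at t within {0..1})"
    using \<gamma> t by (auto simp: lift_def)
  then have "((\<lambda>t. (k, \<gamma> t)) has_vector_derivative (0, inverse (gram (\<gamma> t)) *\<^sub>R velocity k (\<gamma> t)))
      (at t within {0..1})"
    by (intro has_vector_derivative_Pair has_vector_derivative_const)
  then show ?thesis
    using assms by (simp add: flow_field_def rate_def cutoff_eq_one max_absorb1)
qed

lemma F_along:
  assumes "(\<gamma> has_vector_derivative c *\<^sub>R velocity k (\<gamma> t)) (at t within S)"
  shows "((\<lambda>t. F (\<gamma> t)) has_vector_derivative (of_real (c * gram (\<gamma> t)) * fst k) * F (\<gamma> t)) (at t within S)"
proof -
  have "((\<lambda>t. F (\<gamma> t)) has_vector_derivative F' (\<gamma> t) (c *\<^sub>R velocity k (\<gamma> t))) (at t within S)"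
    using vector_derivative_diff_chain_within[OF assms has_derivative_at_withinI[OF F_derivative]]
    by (simp add: o_def)
  then show ?thesis
    by (simp add: linear_scale[OF F'_linear] F'_velocity scaleR_conv_of_real mult.assoc)
qed

lemma lift_F:
  assumes \<gamma>: "lift k \<gamma>" and t: "t \<in> {0..1}"
  shows "F (\<gamma> t) = F (\<gamma> 0) * exp (of_real t * fst k)"
proof -
  have "F (\<gamma> t) = F (\<gamma> 0) * exp (of_real t * fst k - of_real 0 * fst k)"
  proof (rule linear_ode_solution[OF _ _ t])
    fix u :: real assume u: "u \<in> {0..1}"
    then have d: "(\<gamma> has_vector_derivative inverse (gram (\<gamma> u)) *\<^sub>R velocity k (\<gamma> u)) (at u within {0..1})"
      and g: "0 < gram (\<gamma> u)"
      using \<gamma> by (auto simp: lift_def)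
    show "((\<lambda>t. F (\<gamma> t)) has_vector_derivative fst k * F (\<gamma> u)) (at u within {0..1})"
      using F_along[OF d] g by simp
    show "((\<lambda>t. of_real t * fst k) has_vector_derivative fst k) (at u within {0..1})"
      by (auto intro!: derivative_eq_intros simp: has_vector_derivative_def scaleR_conv_of_real)
  qed
  then show ?thesis by simp
qed

lemma lift_fst:
  assumes \<gamma>: "lift k \<gamma>" and t: "t \<in> {0..1}"
  shows "fst (\<gamma> t) = fst (\<gamma> 0) + snd k * t"
proof -
  have "((\<lambda>t. fst (\<gamma> t) - snd k * t) has_vector_derivative 0) (at u within {0..1})"
    if "u \<in> {0..1}" for u
  proof -
    have d: "(\<gamma> has_vector_derivative inverse (gram (\<gamma> u)) *\<^sub>R velocity k (\<gamma> u)) (at u within {0..1})"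
      and g: "0 < gram (\<gamma> u)"
      using \<gamma> that by (auto simp: lift_def)
    have "((\<lambda>t. fst (\<gamma> t)) has_vector_derivative fst (inverse (gram (\<gamma> u)) *\<^sub>R velocity k (\<gamma> u))) (at u within {0..1})"
      by (rule bounded_linear.has_vector_derivative[OF bounded_linear_fst d])
    then have "((\<lambda>t. fst (\<gamma> t)) has_vector_derivative snd k) (at u within {0..1})"
      using g by (simp add: velocity_def mult.left_commute[of "inverse _"])
    from has_vector_derivative_diff[OF this has_vector_derivative_mult_right[OF has_vector_derivative_id, of "snd k"]]
    show ?thesis by simp
  qed
  then obtain c where "\<And>t. t \<in> {0..1} \<Longrightarrow> fst (\<gamma> t) - snd k * t = c"
    using has_vector_derivative_zero_constant[of "{0..1}" "\<lambda>t. fst (\<gamma> t) - snd k * t"] by auto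
  from this[OF t] this[of 0] show ?thesis by simp
qed

lemma lift_continuous: "lift k \<gamma> \<Longrightarrow> continuous_on {0..1} \<gamma>"
  unfolding lift_def continuous_on_eq_continuous_within
  using has_vector_derivative_continuous by blast

lemma lift_bounds:
  assumes \<gamma>: "lift k \<gamma>"
  obtains \<epsilon> R where "0 < \<epsilon>" "\<And>t. t \<in> {0..1} \<Longrightarrow> \<epsilon> \<le> gram (\<gamma> t)"
    "\<And>t. t \<in> {0..1} \<Longrightarrow> norm (k, \<gamma> t) \<le> R"
proof -
  note c = lift_continuous[OF \<gamma>]
  have "continuous_on {0..1} (\<lambda>t. gram (\<gamma> t))"
    by (rule continuous_on_compose2[OF ball_lipschitz_continuous[OF ball_lipschitz_gram] c]) auto
  from continuous_attains_inf[OF compact_Icc _ this]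
  obtain t\<^sub>0 where t\<^sub>0: "t\<^sub>0 \<in> {0..1}" "\<And>t. t \<in> {0..1} \<Longrightarrow> gram (\<gamma> t\<^sub>0) \<le> gram (\<gamma> t)" by auto
  have "continuous_on {0..1} (\<lambda>t. norm (k, \<gamma> t))"
    by (intro continuous_intros c)
  from continuous_attains_sup[OF compact_Icc _ this]
  obtain t\<^sub>1 where "\<And>t. t \<in> {0..1} \<Longrightarrow> norm (k, \<gamma> t) \<le> norm (k, \<gamma> t\<^sub>1)" by force
  moreover have "0 < gram (\<gamma> t\<^sub>0)" using \<gamma> t\<^sub>0 by (auto simp: lift_def)
  ultimately show ?thesis using t\<^sub>0 that by blast
qed

lemma lift_unique:
  assumes a: "lift k \<alpha>" and b: "lift k \<beta>" and 0: "\<alpha> 0 = \<beta> 0" and t: "t \<in> {0..1}"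
  shows "\<alpha> t = \<beta> t"
proof -
  obtain \<epsilon>1 R1 where 1: "0 < \<epsilon>1" "\<And>t. t \<in> {0..1} \<Longrightarrow> \<epsilon>1 \<le> gram (\<alpha> t)"
    "\<And>t. t \<in> {0..1} \<Longrightarrow> norm (k, \<alpha> t) \<le> R1" using lift_bounds[OF a] by metis
  obtain \<epsilon>2 R2 where 2: "0 < \<epsilon>2" "\<And>t. t \<in> {0..1} \<Longrightarrow> \<epsilon>2 \<le> gram (\<beta> t)"
    "\<And>t. t \<in> {0..1} \<Longrightarrow> norm (k, \<beta> t) \<le> R2" using lift_bounds[OF b] by metis
  define \<epsilon> R where "\<epsilon> = min \<epsilon>1 \<epsilon>2" and "R = max R1 R2"
  have "\<epsilon> > 0" using 1 2 by (simp add: \<epsilon>_def)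
  then obtain L where L: "L-lipschitz_on UNIV (flow_field R \<epsilon>)" using flow_field_lipschitz by blast
  have "norm ((k, \<alpha> t) - (k, \<beta> t)) \<le> exp L * norm ((k, \<alpha> 0) - (k, \<beta> 0))"
  proof (rule ode_solutions_dist_le[OF L _ _ t])
    fix u :: real assume u: "u \<in> {0..1}"
    show "((\<lambda>t. (k, \<alpha> t)) has_vector_derivative flow_field R \<epsilon> (k, \<alpha> u)) (at u within {0..1})"
      using 1(2,3)[OF u] \<open>\<epsilon> > 0\<close> by (intro lift_flow a u) (auto simp: \<epsilon>_def R_def)
    show "((\<lambda>t. (k, \<beta> t)) has_vector_derivative flow_field R \<epsilon> (k, \<beta> u)) (at u within {0..1})"
      using 2(2,3)[OF u] \<open>\<epsilon> > 0\<close> by (intro lift_flow b u) (auto simp: \<epsilon>_def R_def)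
  qed
  then show ?thesis using 0 by simp
qed

lemma lift_reverse:
  assumes "lift k \<gamma>" shows "lift (- k) (\<lambda>t. \<gamma> (1 - t))"
  unfolding lift_def
proof (intro ballI conjI)
  fix t :: real assume t: "t \<in> {0..1}"
  then have "1 - t \<in> {0..1}" by auto
  then have *: "norm (snd (\<gamma> (1 - t))) \<le> 1" "0 < gram (\<gamma> (1 - t))"
    "(\<gamma> has_vector_derivative inverse (gram (\<gamma> (1 - t))) *\<^sub>R velocity k (\<gamma> (1 - t)))
       (at (1 - t) within {0..1})"
    using assms by (auto simp: lift_def)
  show "norm (snd (\<gamma> (1 - t))) \<le> 1" "0 < gram (\<gamma> (1 - t))" using * by auto
  have img: "(\<lambda>t. 1 - t) ` {0..1::real} = {0..1}"
    by (auto simp: image_iff intro!: bexI[of _ "1 - _"])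
  have "((\<lambda>t. 1 - t) has_vector_derivative -1) (at t within {0..1})"
    by (auto intro!: derivative_eq_intros)
  from vector_diff_chain_within[OF this, of \<gamma>] *(3)
  show "((\<lambda>t. \<gamma> (1 - t)) has_vector_derivative
      inverse (gram (\<gamma> (1 - t))) *\<^sub>R velocity (- k) (\<gamma> (1 - t))) (at t within {0..1})"
    unfolding img by (simp add: o_def velocity_minus)
qed

text \<open>The hypothesis \<open>safe\<close> only concerns the points of the unit ball over the path that is to be
  lifted. The proof shows, before knowing that \<open>gram \<ge> \<epsilon>\<close>, that a solution of the modified
  equation stays in the ball and over that path, at a time \<open>\<theta> t\<close> between \<open>0\<close> and \<open>1\<close>; then
  \<open>safe\<close> shows that the modification of the field is inactive along the solution.\<close>

lemma lift_exists:
  assumes \<epsilon>: "0 < \<epsilon>" and x: "norm (snd x) \<le> 1"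
    and safe: "\<And>\<theta> y. \<theta> \<in> {0..1} \<Longrightarrow> norm y \<le> 1 \<Longrightarrow>
      F (fst x + snd k * \<theta>, y) = F x * exp (of_real \<theta> * fst k) \<Longrightarrow>
      \<epsilon> \<le> gram (fst x + snd k * \<theta>, y) \<and> norm (k, fst x + snd k * \<theta>, y) \<le> R"
  obtains \<gamma> where "lift k \<gamma>" "\<gamma> 0 = x"
    "\<And>t. t \<in> {0..1} \<Longrightarrow> \<epsilon> \<le> gram (\<gamma> t) \<and> norm (k, \<gamma> t) \<le> R"
proof -
  obtain L where "L-lipschitz_on UNIV (flow_field R \<epsilon>)" using flow_field_lipschitz[OF \<epsilon>] by blast
  from lipschitz_ode_solution[OF this, of "(k, x)"]
  obtain \<Gamma> where \<Gamma>0: "\<Gamma> 0 = (k, x)"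
    and \<Gamma>: "\<And>t. t \<in> {0..1} \<Longrightarrow> (\<Gamma> has_vector_derivative flow_field R \<epsilon> (\<Gamma> t)) (at t within {0..1})"
    by blast
  define \<gamma> where "\<gamma> t = snd (\<Gamma> t)" for t
  have "((\<lambda>t. fst (\<Gamma> t)) has_vector_derivative 0) (at t within {0..1})" if "t \<in> {0..1}" for t
    using bounded_linear.has_vector_derivative[OF bounded_linear_fst \<Gamma>[OF that]]
    by (simp add: flow_field_def)
  then obtain c where c: "\<And>t. t \<in> {0..1} \<Longrightarrow> fst (\<Gamma> t) = c"
    using has_vector_derivative_zero_constant[of "{0..1}" "\<lambda>t. fst (\<Gamma> t)"] by auto
  have \<Gamma>_eq: "\<Gamma> t = (k, \<gamma> t)" if "t \<in> {0..1}" for t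
    using c[OF that] c[of 0] \<Gamma>0 by (simp add: \<gamma>_def prod_eq_iff)
  define \<kappa> where "\<kappa> t = rate R \<epsilon> (\<Gamma> t)" for t
  have \<gamma>: "(\<gamma> has_vector_derivative \<kappa> t *\<^sub>R velocity k (\<gamma> t)) (at t within {0..1})"
    if "t \<in> {0..1}" for t
  proof -
    have "snd (flow_field R \<epsilon> (\<Gamma> t)) = \<kappa> t *\<^sub>R velocity k (\<gamma> t)"
      using \<Gamma>_eq[OF that] by (simp add: flow_field_def \<kappa>_def)
    then show ?thesis
      using bounded_linear.has_vector_derivative[OF bounded_linear_snd \<Gamma>[OF that]]
      unfolding \<gamma>_def[abs_def] by simp
  qed
  have cont\<Gamma>: "continuous_on {0..1} \<Gamma>"
    unfolding continuous_on_eq_continuous_within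
    using \<Gamma> has_vector_derivative_continuous by blast
  have cont_gram: "continuous_on {0..1} (\<lambda>t. gram (snd (\<Gamma> t)))"
    by (rule continuous_on_compose2[OF ball_lipschitz_continuous[OF ball_lipschitz_gram]])
      (auto intro!: continuous_intros cont\<Gamma>)
  have cont_\<kappa>: "continuous_on {0..1} \<kappa>"
    unfolding \<kappa>_def rate_def cutoff_def using \<epsilon>
    by (intro continuous_intros cont\<Gamma> cont_gram) (simp add: max_def)
  have cont_\<gamma>: "continuous_on {0..1} \<gamma>"
    unfolding \<gamma>_def[abs_def] by (intro continuous_intros cont\<Gamma>)

  define w where "w t = fst k * F (\<gamma> t) - snd k *\<^sub>R F' (\<gamma> t) (1, 0)" for t
  define a where "a t = - (2 * \<kappa> t * (grad (cramer (\<gamma> t) (w t)) (\<gamma> t) \<bullet> snd (\<gamma> t)))" for t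
  have cont_a: "continuous_on {0..1} a"
  proof -
    have cF: "continuous_on {0..1} (\<lambda>t. F (\<gamma> t))" "continuous_on {0..1} (\<lambda>t. F' (\<gamma> t) v)"
       "continuous_on {0..1} (\<lambda>t. quad (\<gamma> t) m n)" for v m n
      by (rule continuous_on_compose2[OF ball_lipschitz_continuous cont_\<gamma>],
        auto intro: F_ball_lipschitz F'_ball_lipschitz ball_lipschitz_quad)+
    show ?thesis
      unfolding a_def w_def cramer_def grad_def by (intro continuous_intros cont_\<kappa> cF cont_\<gamma>)
  qed
  have ball: "norm (snd (\<gamma> t)) \<le> 1" if t: "t \<in> {0..1}" for t
  proof -
    define g where "g t = 1 - (norm (snd (\<gamma> t)))\<^sup>2" for t
    have "g t = g 0 * exp (integral {0..t} a - integral {0..0} a)"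
    proof (rule linear_ode_solution[OF _ _ t])
      fix u :: real assume u: "u \<in> {0..1}"
      show "((\<lambda>t. integral {0..t} a) has_vector_derivative a u) (at u within {0..1})"
        by (rule integral_has_vector_derivative[OF cont_a u])
      have "((\<lambda>t. snd (\<gamma> t)) has_vector_derivative snd (\<kappa> u *\<^sub>R velocity k (\<gamma> u))) (at u within {0..1})"
        by (rule bounded_linear.has_vector_derivative[OF bounded_linear_snd \<gamma>[OF u]])
      then have "(g has_vector_derivative - (2 * (snd (\<gamma> u) \<bullet> snd (\<kappa> u *\<^sub>R velocity k (\<gamma> u))))) (at u within {0..1})"
        using has_vector_derivative_diff[OF has_vector_derivative_const
          bounded_bilinear.has_vector_derivative[OF bounded_bilinear_inner]]
        unfolding g_def power2_norm_eq_inner by (fastforce simp: inner_commute)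
      also have "snd (\<gamma> u) \<bullet> snd (\<kappa> u *\<^sub>R velocity k (\<gamma> u))
          = \<kappa> u * (snd (\<gamma> u) \<bullet> tangential (\<gamma> u) (grad (cramer (\<gamma> u) (w u)) (\<gamma> u)))"
        by (simp add: velocity_def w_def)
      also have "- (2 * \<dots>) = a u * g u"
        unfolding inner_tangential by (simp add: a_def g_def algebra_simps)
      finally show "(g has_vector_derivative a u * g u) (at u within {0..1})" .
    qed
    moreover have "0 \<le> g 0" using x \<Gamma>0 by (simp add: g_def \<gamma>_def power_le_one)
    ultimately have "0 \<le> g t" by simp
    then show ?thesis by (simp add: g_def abs_square_le_1)
  qed

  (* The solution runs through the prescribed path with speed \<open>h \<le> 1\<close>. *)
  define h where "h t = \<kappa> t * gram (\<gamma> t)" for t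
  define \<theta> where "\<theta> t = integral {0..t} h" for t
  have cont_h: "continuous_on {0..1} h"
    unfolding h_def using cont_gram by (intro continuous_intros cont_\<kappa>) (simp add: \<gamma>_def)
  have \<theta>: "(\<theta> has_vector_derivative h u) (at u within {0..1})" if "u \<in> {0..1}" for u
    unfolding \<theta>_def by (rule integral_has_vector_derivative[OF cont_h that])
  have \<theta>0: "\<theta> 0 = 0" by (simp add: \<theta>_def)
  have h: "0 \<le> h t" "h t \<le> 1" if t: "t \<in> {0..1}" for t
  proof -
    have g: "0 \<le> gram (\<gamma> t)" by (rule gram_nonneg[OF ball[OF t]])
    have m: "max (gram (\<gamma> t)) \<epsilon> > 0" using \<epsilon> by auto
    then show "0 \<le> h t"
      using g by (simp add: h_def \<kappa>_def rate_def \<gamma>_def cutoff_nonneg)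
    have "cutoff R (\<Gamma> t) * (inverse (max (gram (\<gamma> t)) \<epsilon>) * gram (\<gamma> t)) \<le> 1 * 1"
      using g m by (intro mult_mono cutoff_le_one cutoff_nonneg) (auto simp: field_simps)
    then show "h t \<le> 1" by (simp add: h_def \<kappa>_def rate_def \<gamma>_def)
  qed
  have \<theta>01: "\<theta> t \<in> {0..1}" if t: "t \<in> {0..1}" for t
  proof -
    have int: "h integrable_on {0..t}"
      by (rule integrable_continuous_real[OF continuous_on_subset[OF cont_h]]) (use t in auto)
    have "0 \<le> \<theta> t"
      unfolding \<theta>_def by (rule integral_nonneg[OF int]) (use t h in auto)
    moreover have "\<theta> t \<le> integral {0..t} (\<lambda>x. 1)"
      unfolding \<theta>_def by (rule integral_le[OF int]) (use t h in auto)
    ultimately show ?thesis using t by simp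
  qed
  have F\<gamma>: "F (\<gamma> t) = F x * exp (of_real (\<theta> t) * fst k)" if t: "t \<in> {0..1}" for t
  proof -
    have "F (\<gamma> t) = F (\<gamma> 0) * exp (of_real (\<theta> t) * fst k - of_real (\<theta> 0) * fst k)"
    proof (rule linear_ode_solution[OF _ _ t])
      fix u :: real assume u: "u \<in> {0..1}"
      show "((\<lambda>t. F (\<gamma> t)) has_vector_derivative (of_real (h u) * fst k) * F (\<gamma> u)) (at u within {0..1})"
        using F_along[OF \<gamma>[OF u]] by (simp add: h_def)
      have "((\<lambda>t. of_real (\<theta> t)::complex) has_vector_derivative of_real (h u)) (at u within {0..1})"
        by (rule bounded_linear.has_vector_derivative[OF bounded_linear_of_real \<theta>[OF u]])
      from has_vector_derivative_mult_left[OF this]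
      show "((\<lambda>t. of_real (\<theta> t) * fst k) has_vector_derivative of_real (h u) * fst k) (at u within {0..1})" .
    qed
    then show ?thesis by (simp add: \<theta>0) (simp add: \<gamma>_def \<Gamma>0)
  qed
  have fst\<gamma>: "fst (\<gamma> t) = fst x + snd k * \<theta> t" if t: "t \<in> {0..1}" for t
  proof -
    have "((\<lambda>t. fst (\<gamma> t) - snd k * \<theta> t) has_vector_derivative 0) (at u within {0..1})"
      if u: "u \<in> {0..1}" for u
    proof -
      have "((\<lambda>t. fst (\<gamma> t)) has_vector_derivative fst (\<kappa> u *\<^sub>R velocity k (\<gamma> u))) (at u within {0..1})"
        by (rule bounded_linear.has_vector_derivative[OF bounded_linear_fst \<gamma>[OF u]])
      then have "((\<lambda>t. fst (\<gamma> t)) has_vector_derivative snd k * h u) (at u within {0..1})"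
        by (simp add: velocity_def h_def algebra_simps)
      from has_vector_derivative_diff[OF this has_vector_derivative_mult_right[OF \<theta>[OF u], of "snd k"]]
      show ?thesis by simp
    qed
    then obtain c where "\<And>t. t \<in> {0..1} \<Longrightarrow> fst (\<gamma> t) - snd k * \<theta> t = c"
      using has_vector_derivative_zero_constant[of "{0..1}" "\<lambda>t. fst (\<gamma> t) - snd k * \<theta> t"] by auto
    from this[OF t] this[of 0] show ?thesis using \<theta>0 \<Gamma>0 by (simp add: \<gamma>_def)
  qed
  have bounds: "\<epsilon> \<le> gram (\<gamma> t) \<and> norm (k, \<gamma> t) \<le> R" if t: "t \<in> {0..1}" for t
    using safe[OF \<theta>01[OF t] ball[OF t]] F\<gamma>[OF t] fst\<gamma>[OF t]
    by (metis prod.collapse)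
  have "lift k \<gamma>"
    unfolding lift_def
  proof (intro ballI conjI)
    fix t :: real assume t: "t \<in> {0..1}"
    show "norm (snd (\<gamma> t)) \<le> 1" by (rule ball[OF t])
    show "0 < gram (\<gamma> t)" using bounds[OF t] \<epsilon> by simp
    have "\<kappa> t = inverse (gram (\<gamma> t))"
      using bounds[OF t] by (simp add: \<kappa>_def rate_def \<Gamma>_eq[OF t] cutoff_eq_one max_absorb1)
    then show "(\<gamma> has_vector_derivative inverse (gram (\<gamma> t)) *\<^sub>R velocity k (\<gamma> t)) (at t within {0..1})"
      using \<gamma>[OF t] by simp
  qed
  then show ?thesis using bounds \<Gamma>0 by (intro that[of \<gamma>]) (auto simp: \<gamma>_def)
qed

section \<open>Transport of fibers\<close>

text \<open>Every point of the unit ball over the path prescribed by \<open>k\<close> and starting at the image of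
  \<open>x\<close> is regular.\<close>

definition liftable :: "complex \<times> real \<Rightarrow> real \<times> 'a \<Rightarrow> bool" where
  "liftable k x \<longleftrightarrow> norm (snd x) \<le> 1 \<and>
     (\<forall>\<theta>\<in>{0..1}. \<forall>y. norm y \<le> 1 \<longrightarrow> F (fst x + snd k * \<theta>, y) = F x * exp (of_real \<theta> * fst k) \<longrightarrow>
        0 < gram (fst x + snd k * \<theta>, y))"

definition transport :: "complex \<times> real \<Rightarrow> real \<times> 'a \<Rightarrow> real \<times> 'a" where
  "transport k x = (SOME x'. \<exists>\<gamma>. lift k \<gamma> \<and> \<gamma> 0 = x \<and> \<gamma> 1 = x')"

text \<open>The points of the unit ball over the paths that belong to a compact set of data form a
  compact set.\<close>

lemma liftable_uniform:
  assumes T: "compact T" and good: "\<And>k x. (k, x) \<in> T \<Longrightarrow> liftable k x"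
  obtains \<epsilon> R where "0 < \<epsilon>"
    "\<And>k x \<theta> y. (k, x) \<in> T \<Longrightarrow> \<theta> \<in> {0..1} \<Longrightarrow> norm y \<le> 1 \<Longrightarrow>
      F (fst x + snd k * \<theta>, y) = F x * exp (of_real \<theta> * fst k) \<Longrightarrow>
      \<epsilon> \<le> gram (fst x + snd k * \<theta>, y) \<and> norm (k, fst x + snd k * \<theta>, y) \<le> R"
proof -
  define pos where "pos q = (fst (snd (fst q)) + snd (fst (fst q)) * fst (snd q), snd (snd q))"
    for q :: "((complex \<times> real) \<times> real \<times> 'a) \<times> real \<times> 'a"
  define excess where "excess q = F (pos q) - F (snd (fst q)) * exp (of_real (fst (snd q)) * fst (fst (fst q)))"
    for q
  define K where "K = (T \<times> {0..1} \<times> cball 0 1) \<inter> excess -` {0}"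
  have cont_pos: "continuous_on S pos" for S
    unfolding pos_def by (intro continuous_intros)
  have F: "continuous_on S (\<lambda>q. F (g q))" if "continuous_on S g" for S and g :: "_ \<Rightarrow> real \<times> 'a"
    by (rule continuous_on_compose2[OF ball_lipschitz_continuous[OF F_ball_lipschitz] that]) auto
  have "continuous_on UNIV excess"
    unfolding excess_def by (intro continuous_intros F cont_pos)
  then have "closed (excess -` {0})"
    by (simp add: closed_vimage)
  then have K: "compact K"
    unfolding K_def by (intro compact_Int_closed compact_Times T compact_Icc compact_cball)
  have cont_gram: "continuous_on K (\<lambda>q. gram (pos q))"
    by (rule continuous_on_compose2[OF ball_lipschitz_continuous[OF ball_lipschitz_gram] cont_pos]) auto
  have pos: "0 < gram (pos q)" if "q \<in> K" for q
  proof -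
    have q: "(fst (fst q), snd (fst q)) \<in> T" "fst (snd q) \<in> {0..1}" "norm (snd (snd q)) \<le> 1"
      "F (pos q) = F (snd (fst q)) * exp (of_real (fst (snd q)) * fst (fst (fst q)))"
      using that by (auto simp: K_def excess_def)
    then show ?thesis using good[OF q(1)] unfolding liftable_def pos_def by blast
  qed
  have "bounded ((\<lambda>q. (fst (fst q), pos q)) ` K)"
    by (intro compact_imp_bounded compact_continuous_image K continuous_intros cont_pos)
  then obtain R where R: "\<And>q. q \<in> K \<Longrightarrow> norm (fst (fst q), pos q) \<le> R"
    unfolding bounded_iff by blast
  obtain \<epsilon> where \<epsilon>: "0 < \<epsilon>" "\<And>q. q \<in> K \<Longrightarrow> \<epsilon> \<le> gram (pos q)"
  proof (cases "K = {}")
    case True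
    then show ?thesis using that[of 1] by simp
  next
    case False
    from continuous_attains_inf[OF K False cont_gram] pos that show ?thesis by metis
  qed
  show ?thesis
  proof (rule that[OF \<epsilon>(1)])
    fix k x \<theta> y
    assume "(k, x) \<in> T" "\<theta> \<in> {0..1}" "norm y \<le> 1"
      "F (fst x + snd k * \<theta>, y) = F x * exp (of_real \<theta> * fst k)"
    then have "((k, x), \<theta>, y) \<in> K" by (auto simp: K_def excess_def pos_def)
    from \<epsilon>(2)[OF this] R[OF this]
    show "\<epsilon> \<le> gram (fst x + snd k * \<theta>, y) \<and> norm (k, fst x + snd k * \<theta>, y) \<le> R"
      by (simp add: pos_def)
  qed
qed

lemma transport_eq:
  assumes "lift k \<gamma>" "\<gamma> 0 = x"
  shows "transport k x = \<gamma> 1"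
  unfolding transport_def
proof (rule some_equality)
  show "\<exists>\<gamma>'. lift k \<gamma>' \<and> \<gamma>' 0 = x \<and> \<gamma>' 1 = \<gamma> 1" using assms by blast
  fix x' assume "\<exists>\<gamma>. lift k \<gamma> \<and> \<gamma> 0 = x \<and> \<gamma> 1 = x'"
  then obtain \<gamma>' where "lift k \<gamma>'" "\<gamma>' 0 = x" "\<gamma>' 1 = x'" by blast
  then show "x' = \<gamma> 1" using lift_unique[of k \<gamma>' \<gamma> 1] assms by simp
qed

lemma transport_lift:
  assumes "liftable k x"
  obtains \<gamma> where "lift k \<gamma>" "\<gamma> 0 = x" "\<gamma> 1 = transport k x"
proof -
  have T: "compact {(k, x)}" by simp
  have good: "liftable k' x'" if "(k', x') \<in> {(k, x)}" for k' x'
    using assms that by simp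
  obtain \<epsilon> R where \<epsilon>: "0 < \<epsilon>" and safe: "\<And>k' x' \<theta> y. (k', x') \<in> {(k, x)} \<Longrightarrow> \<theta> \<in> {0..1} \<Longrightarrow>
      norm y \<le> 1 \<Longrightarrow> F (fst x' + snd k' * \<theta>, y) = F x' * exp (of_real \<theta> * fst k') \<Longrightarrow>
      \<epsilon> \<le> gram (fst x' + snd k' * \<theta>, y) \<and> norm (k', fst x' + snd k' * \<theta>, y) \<le> R"
    by (rule liftable_uniform[OF T good], assumption, rule that)
  have "norm (snd x) \<le> 1" using assms by (simp add: liftable_def)
  then obtain \<gamma> where "lift k \<gamma>" "\<gamma> 0 = x"
    by (rule lift_exists[OF \<epsilon> _ safe[OF singletonI]])
  from that[OF this transport_eq[OF this, symmetric]] show ?thesis .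
qed

lemma
  assumes "liftable k x"
  shows transport_fst: "fst (transport k x) = fst x + snd k"
    and transport_F: "F (transport k x) = F x * exp (fst k)"
    and transport_norm: "norm (snd (transport k x)) \<le> 1"
    and transport_inverse: "transport (- k) (transport k x) = x"
proof -
  obtain \<gamma> where \<gamma>: "lift k \<gamma>" "\<gamma> 0 = x" "\<gamma> 1 = transport k x"
    using transport_lift[OF assms] by blast
  show "fst (transport k x) = fst x + snd k" "F (transport k x) = F x * exp (fst k)"
    unfolding \<gamma>(3)[symmetric] using lift_fst[OF \<gamma>(1), of 1] lift_F[OF \<gamma>(1), of 1]
    by (simp_all add: \<gamma>(2))
  show "norm (snd (transport k x)) \<le> 1"
    using \<gamma>(1) unfolding \<gamma>(3)[symmetric] lift_def by simp
  show "transport (- k) (transport k x) = x"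
    unfolding \<gamma>(3)[symmetric] using transport_eq[OF lift_reverse[OF \<gamma>(1)]] by (simp add: \<gamma>(2))
qed

lemma liftable_transport:
  assumes "liftable k x" shows "liftable (- k) (transport k x)"
  unfolding liftable_def
proof (intro conjI ballI allI impI)
  show "norm (snd (transport k x)) \<le> 1" by (rule transport_norm[OF assms])
  fix \<theta> :: real and y
  assume \<theta>: "\<theta> \<in> {0..1}" and y: "norm y \<le> 1"
    and eq: "F (fst (transport k x) + snd (- k) * \<theta>, y)
      = F (transport k x) * exp (of_real \<theta> * fst (- k))"
  have pos: "fst (transport k x) + snd (- k) * \<theta> = fst x + snd k * (1 - \<theta>)"
    by (simp add: transport_fst[OF assms] algebra_simps)
  have "F (transport k x) * exp (of_real \<theta> * fst (- k)) = F x * exp (of_real (1 - \<theta>) * fst k)"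
    by (simp add: transport_F[OF assms] algebra_simps flip: exp_add)
  then show "0 < gram (fst (transport k x) + snd (- k) * \<theta>, y)"
    using assms \<theta> y eq unfolding pos liftable_def by auto
qed

text \<open>A sequence of data together with its limit is compact, so one Lipschitz field serves all of
  it.\<close>

lemma continuous_on_transport:
  "continuous_on {p. liftable (fst p) (snd p)} (\<lambda>p. transport (fst p) (snd p))"
proof (rule continuous_on_sequentiallyI)
  fix u a
  assume u: "\<forall>n. u n \<in> {p. liftable (fst p) (snd p)}" and a: "a \<in> {p. liftable (fst p) (snd p)}"
    and lim: "u \<longlonglongrightarrow> a"
  define T where "T = insert a (range u)"
  have T: "compact T" unfolding T_def using lim by (rule compact_sequence_with_limit)
  have good: "liftable k x" if "(k, x) \<in> T" for k x
    using that u a by (auto simp: T_def) (metis fst_conv snd_conv)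
  obtain \<epsilon> R where \<epsilon>: "0 < \<epsilon>" and safe: "\<And>k x \<theta> y. (k, x) \<in> T \<Longrightarrow> \<theta> \<in> {0..1} \<Longrightarrow> norm y \<le> 1 \<Longrightarrow>
      F (fst x + snd k * \<theta>, y) = F x * exp (of_real \<theta> * fst k) \<Longrightarrow>
      \<epsilon> \<le> gram (fst x + snd k * \<theta>, y) \<and> norm (k, fst x + snd k * \<theta>, y) \<le> R"
    by (rule liftable_uniform[OF T good], assumption, rule that)
  obtain L where L: "L-lipschitz_on UNIV (flow_field R \<epsilon>)" using flow_field_lipschitz[OF \<epsilon>] by blast
  have ex: "\<exists>\<Gamma>. \<Gamma> 0 = p \<and> \<Gamma> 1 = (fst p, transport (fst p) (snd p)) \<and>
      (\<forall>t\<in>{0..1}. (\<Gamma> has_vector_derivative flow_field R \<epsilon> (\<Gamma> t)) (at t within {0..1}))"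
    if p: "p \<in> T" for p
  proof -
    obtain \<gamma> where \<gamma>: "lift (fst p) \<gamma>" "\<gamma> 0 = snd p"
      "\<And>t. t \<in> {0..1} \<Longrightarrow> \<epsilon> \<le> gram (\<gamma> t) \<and> norm (fst p, \<gamma> t) \<le> R"
    proof (rule lift_exists[OF \<epsilon>, of "snd p" "fst p" R])
      show "norm (snd (snd p)) \<le> 1" using good[of "fst p" "snd p"] p by (simp add: liftable_def)
    qed (use safe[of "fst p" "snd p"] p in auto)
    then show ?thesis
      using transport_eq[OF \<gamma>(1,2)] \<epsilon>
      by (intro exI[of _ "\<lambda>t. (fst p, \<gamma> t)"]) (auto intro!: lift_flow)
  qed
  have bound: "norm (transport (fst p) (snd p) - transport (fst a) (snd a)) \<le> exp L * norm (p - a)"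
    if p: "p \<in> T" for p
  proof -
    obtain \<Gamma> where \<Gamma>: "\<Gamma> 0 = p" "\<Gamma> 1 = (fst p, transport (fst p) (snd p))"
      "\<And>t. t \<in> {0..1} \<Longrightarrow> (\<Gamma> has_vector_derivative flow_field R \<epsilon> (\<Gamma> t)) (at t within {0..1})"
      using ex[OF p] by blast
    obtain \<Delta> where \<Delta>: "\<Delta> 0 = a" "\<Delta> 1 = (fst a, transport (fst a) (snd a))"
      "\<And>t. t \<in> {0..1} \<Longrightarrow> (\<Delta> has_vector_derivative flow_field R \<epsilon> (\<Delta> t)) (at t within {0..1})"
      using ex[of a] by (auto simp: T_def)
    have "norm (\<Gamma> 1 - \<Delta> 1) \<le> exp L * norm (p - a)"
      using ode_solutions_dist_le[OF L \<Gamma>(3) \<Delta>(3), of 1] \<Gamma>(1) \<Delta>(1) by simp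
    then show ?thesis
      using norm_snd_le[where x = "fst p - fst a" and
        y = "transport (fst p) (snd p) - transport (fst a) (snd a)"] \<Gamma>(2) \<Delta>(2) by simp
  qed
  have "(\<lambda>n. exp L * norm (u n - a)) \<longlonglongrightarrow> exp L * norm (a - a)"
    by (intro tendsto_intros lim)
  then have null: "(\<lambda>n. exp L * norm (u n - a)) \<longlonglongrightarrow> 0" by simp
  have "\<forall>n. norm (transport (fst (u n)) (snd (u n)) - transport (fst a) (snd a))
      \<le> exp L * norm (u n - a)"
    by (intro allI bound) (simp add: T_def)
  from Lim_null_comparison[OF always_eventually[OF this] null]
  show "(\<lambda>n. transport (fst (u n)) (snd (u n))) \<longlonglongrightarrow> transport (fst a) (snd a)"
    by (simp add: LIM_zero_iff)
qed

end

section \<open>Scaled mixed polynomials\<close>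

text \<open>Stated for a substitution \<open>g\<close>, so that it covers both \<open>f z\<close> and \<open>f (s y)\<close>.\<close>

lemma mixed_eval_lipschitz_diff:
  fixes f :: "'n::finite mixed_poly" and g :: "'b::real_normed_vector \<Rightarrow> complex ^ 'n"
  assumes "\<And>i. \<exists>g'. lipschitz_diff (\<lambda>x. g x $ i) g'" "\<And>i. \<exists>g'. lipschitz_diff (\<lambda>x. cnj (g x $ i)) g'"
  shows "\<exists>F'. lipschitz_diff (\<lambda>x. mixed_eval f (g x)) F'"
  unfolding mixed_eval_def case_prod_beta
  by (intro lipschitz_diff_sum lipschitz_diff_mult lipschitz_diff_const lipschitz_diff_prod
      lipschitz_diff_power assms)

lemma mixed_eval_has_derivative:
  "(mixed_eval f has_derivative frechet_derivative (mixed_eval f) (at z)) (at z)"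
proof -
  have "\<exists>F'. lipschitz_diff (\<lambda>z. mixed_eval f z) F'"
    by (intro mixed_eval_lipschitz_diff lipschitz_diff_linear bounded_linear_vec_nth
      bounded_linear_compose[OF bounded_linear_cnj bounded_linear_vec_nth])
  then have "mixed_eval f differentiable at z"
    by (auto simp: lipschitz_diff_def differentiable_def)
  then show ?thesis by (simp add: frechet_derivative_works)
qed

lemma continuous_on_mixed_eval: "continuous_on S (mixed_eval f)"
  by (meson has_derivative_continuous mixed_eval_has_derivative continuous_at_imp_continuous_on)

lemma scaled_mixed_eval_lipschitz_diff:
  "\<exists>F'. lipschitz_diff (\<lambda>x. mixed_eval f (fst x *\<^sub>R snd x)) F'"
proof (rule mixed_eval_lipschitz_diff)
  fix i
  have s: "\<exists>F'. lipschitz_diff (\<lambda>x::real \<times> (complex ^ 'a). complex_of_real (fst x)) F'"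
    by (intro lipschitz_diff_linear bounded_linear_compose[OF bounded_linear_of_real bounded_linear_fst])
  have y: "\<exists>F'. lipschitz_diff (\<lambda>x::real \<times> (complex ^ 'a). snd x $ i) F'"
    by (intro lipschitz_diff_linear bounded_linear_compose[OF bounded_linear_vec_nth bounded_linear_snd])
  have c: "\<exists>F'. lipschitz_diff (\<lambda>x::real \<times> (complex ^ 'a). cnj (snd x $ i)) F'"
    by (intro lipschitz_diff_linear bounded_linear_compose[OF bounded_linear_cnj]
      bounded_linear_compose[OF bounded_linear_vec_nth bounded_linear_snd])
  show "\<exists>F'. lipschitz_diff (\<lambda>x::real \<times> (complex ^ 'a). (fst x *\<^sub>R snd x) $ i) F'"
    unfolding vector_scaleR_component scaleR_conv_of_real[where 'a = complex] by (rule lipschitz_diff_mult[OF s y])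
  show "\<exists>F'. lipschitz_diff (\<lambda>x::real \<times> (complex ^ 'a). cnj ((fst x *\<^sub>R snd x) $ i)) F'"
    unfolding vector_scaleR_component scaleR_conv_of_real[where 'a = complex] complex_cnj_mult complex_cnj_complex_of_real
    by (rule lipschitz_diff_mult[OF s c])
qed

lemma not_critical_imp_surj:
  assumes "\<not> critical_point (mixed_eval f) z"
  shows "surj (frechet_derivative (mixed_eval f) (at z))"
proof -
  let ?D = "frechet_derivative (mixed_eval f) (at z)"
  have lin: "linear ?D" using mixed_eval_has_derivative has_derivative_linear by blast
  have "dim (range ?D) = DIM(complex)"
    using assms dim_subset_UNIV[of "range ?D"] by (simp add: critical_along_def)
  then have "span (range ?D) = UNIV" by (simp only: dim_eq_full)
  moreover have "subspace (range ?D)" using lin subspace_UNIV by (rule linear_subspace_image)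
  ultimately show ?thesis by (metis span_eq_iff)
qed

locale scaled_mixed_poly =
  fixes f :: "'n::finite mixed_poly" and F' :: "real \<times> (complex ^ 'n) \<Rightarrow> real \<times> (complex ^ 'n) \<Rightarrow> complex"
  assumes lipschitz_diff: "lipschitz_diff (\<lambda>x. mixed_eval f (fst x *\<^sub>R snd x)) F'"

sublocale scaled_mixed_poly \<subseteq> ball_family "\<lambda>x. mixed_eval f (fst x *\<^sub>R snd x)" F'
  using lipschitz_diff by unfold_locales

context scaled_mixed_poly
begin

lemma F'_fiber: "F' (s, y) (0, v) = s *\<^sub>R frechet_derivative (mixed_eval f) (at (s *\<^sub>R y)) v"
proof -
  let ?D = "frechet_derivative (mixed_eval f) (at (s *\<^sub>R y))"
  have "((\<lambda>y. (s, y)) has_derivative (\<lambda>v. (0, v))) (at y)"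
    by (auto intro!: derivative_eq_intros)
  from has_derivative_compose[OF this F_derivative]
  have 1: "((\<lambda>y. mixed_eval f (s *\<^sub>R y)) has_derivative (\<lambda>v. F' (s, y) (0, v))) (at y)" by simp
  have "((\<lambda>y. s *\<^sub>R y) has_derivative (\<lambda>v. s *\<^sub>R v)) (at y)"
    by (auto intro!: derivative_eq_intros)
  from has_derivative_compose[OF this mixed_eval_has_derivative]
  have 2: "((\<lambda>y. mixed_eval f (s *\<^sub>R y)) has_derivative (\<lambda>v. ?D (s *\<^sub>R v))) (at y)" by simp
  have "linear ?D" using mixed_eval_has_derivative has_derivative_linear by blast
  then have "?D (s *\<^sub>R v) = s *\<^sub>R ?D v" by (rule linear_scale)
  then show ?thesis using has_derivative_unique[OF 1 2] by metis
qed

text \<open>If \<open>A (J\<^sup>T m) = 0\<close>, then \<open>J\<^sup>T m\<close> is a multiple \<open>c y\<close> of the position vector. Inside the ball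
  this multiple is zero. On the sphere, transversality writes every vector as a sum of one
  tangent to the fiber and one orthogonal to \<open>y\<close>, and \<open>m \<bullet> J\<close> vanishes on both. In either case
  \<open>m\<close> is orthogonal to the image of \<open>J\<close>, which is the whole plane.\<close>

lemma gram_pos_of_transverse:
  assumes s: "0 < s" and y: "norm y \<le> 1"
    and regular: "\<not> critical_point (mixed_eval f) (s *\<^sub>R y)"
    and trans: "transverse_to_sphere UNIV (mixed_eval f) (mixed_eval f -` {mixed_eval f (s *\<^sub>R y)}) s"
  shows "0 < gram (s, y)"
proof (rule gram_pos)
  show "norm (snd (s, y)) \<le> 1" using y by simp
  fix m assume "tangential (s, y) (grad m (s, y)) = 0"
  define D where "D = frechet_derivative (mixed_eval f) (at (s *\<^sub>R y))"
  have lin: "linear D" unfolding D_def using mixed_eval_has_derivative has_derivative_linear by blast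
  define c where "c = grad m (s, y) \<bullet> y"
  have grad: "grad m (s, y) = c *\<^sub>R y"
    using \<open>tangential (s, y) (grad m (s, y)) = 0\<close> by (simp add: tangential_def c_def)
  have mD: "m \<bullet> D v * s = c * (y \<bullet> v)" for v
    using grad_inner[of m "(s, y)" v] by (simp add: grad F'_fiber D_def)
  have "m \<bullet> D v = 0" for v
  proof (cases "norm y < 1")
    case True
    have "c = c * (y \<bullet> y)" using grad c_def by (metis inner_scaleR_left)
    moreover have "y \<bullet> y \<noteq> 1"
      using True by (metis norm_eq_1 less_irrefl)
    ultimately have "c = 0" by auto
    then show ?thesis using mD[of v] s by simp
  next
    case False
    then have "s *\<^sub>R y \<in> sphere 0 s" using y s by simp
    then have "{a + b | a b. a \<in> fiber_tangent UNIV (mixed_eval f) (s *\<^sub>R y) \<and> s *\<^sub>R y \<bullet> b = 0} = UNIV"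
      using trans unfolding transverse_to_sphere_def by blast
    then have "v \<in> {a + b | a b. a \<in> fiber_tangent UNIV (mixed_eval f) (s *\<^sub>R y) \<and> s *\<^sub>R y \<bullet> b = 0}"
      by simp
    then obtain a b where ab: "v = a + b" "D a = 0" "y \<bullet> b = 0"
      using s by (auto simp: fiber_tangent_def D_def)
    then have "D v = D b" using linear_add[OF lin, of a b] by simp
    then show ?thesis using mD[of b] ab s by simp
  qed
  moreover obtain v where "m = D v"
    using not_critical_imp_surj[OF regular] unfolding D_def by (metis surjD)
  ultimately show "m = 0" by (metis inner_eq_zero_iff)
qed

end

text \<open>The pair \<open>(w, c)\<close> moves the point \<open>z\<close> of the ball of radius \<open>s\<close> to a point of the ball of
  radius \<open>s + c\<close>, multiplying the value of \<open>f\<close> by \<open>e\<^sup>w\<close>. Only the endpoints of the path are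
  constrained: \<open>|\<eta> e\<^sup>\<theta>\<^sup>w|\<close> is monotone in \<open>\<theta>\<close>, so what lies between them is within bounds as
  well.\<close>

definition transport_domain ::
    "'n::finite mixed_poly \<Rightarrow> real \<Rightarrow> real \<Rightarrow> real \<Rightarrow> ((complex \<times> real) \<times> real \<times> (complex ^ 'n)) set" where
  "transport_domain f r \<rho> d = {((w, c), (s, z)).
     s \<in> {r..\<rho>} \<and> s + c \<in> {r..\<rho>} \<and> norm z \<le> s \<and> 0 < cmod (mixed_eval f z) \<and>
     cmod (mixed_eval f z) \<le> d \<and> cmod (mixed_eval f z * exp w) \<le> d}"

text \<open>Transport in the coordinates of the original balls. The fibrations are built from these
  properties of \<open>\<Phi>\<close> alone.\<close>

lemma fiber_transport:
  fixes f :: "'n::finite mixed_poly"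
  assumes r: "0 < r" and level: "stable_level f \<rho> r d"
  obtains \<Phi> :: "(complex \<times> real) \<times> real \<times> (complex ^ 'n) \<Rightarrow> complex ^ 'n" where
    "continuous_on (transport_domain f r \<rho> d) \<Phi>"
    "\<And>w c s z. ((w, c), (s, z)) \<in> transport_domain f r \<rho> d \<Longrightarrow>
       norm (\<Phi> ((w, c), (s, z))) \<le> s + c \<and> mixed_eval f (\<Phi> ((w, c), (s, z))) = mixed_eval f z * exp w \<and>
       \<Phi> ((- w, - c), (s + c, \<Phi> ((w, c), (s, z)))) = z"
proof -
  obtain F' where "lipschitz_diff (\<lambda>x. mixed_eval f (fst x *\<^sub>R snd x)) F'"
    using scaled_mixed_eval_lipschitz_diff by blast
  then interpret scaled_mixed_poly f F' by unfold_locales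
  define A where "A = transport_domain f r \<rho> d"
  define \<iota> where "\<iota> p = (fst p, (fst (snd p), (1 / fst (snd p)) *\<^sub>R snd (snd p)))"
    for p :: "(complex \<times> real) \<times> real \<times> (complex ^ 'n)"
  define \<Phi> where "\<Phi> p = (fst (snd p) + snd (fst p)) *\<^sub>R
      snd (transport (fst (\<iota> p)) (snd (\<iota> p)))" for p
  have pos: "0 < gram (s, y)"
    if "s \<in> {r..\<rho>}" "norm y \<le> 1" "0 < cmod (mixed_eval f (s *\<^sub>R y))" "cmod (mixed_eval f (s *\<^sub>R y)) \<le> d"
    for s y
  proof (rule gram_pos_of_transverse)
    show "0 < s" "norm y \<le> 1" using that r by auto
    have "norm (s *\<^sub>R y) \<le> s * 1"
      using that r unfolding norm_scaleR by (intro mult_mono) auto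
    then have "s *\<^sub>R y \<in> cball 0 \<rho>" using that by simp
    then show "\<not> critical_point (mixed_eval f) (s *\<^sub>R y)"
      using level that unfolding stable_level_def by blast
    show "transverse_to_sphere UNIV (mixed_eval f) (mixed_eval f -` {mixed_eval f (s *\<^sub>R y)}) s"
      using level that unfolding stable_level_def by auto
  qed
  have liftable: "liftable (fst (\<iota> p)) (snd (\<iota> p))" if "p \<in> A" for p
  proof -
    obtain w c s z where p: "p = ((w, c), (s, z))" by (metis prod.collapse)
    have A: "s \<in> {r..\<rho>}" "s + c \<in> {r..\<rho>}" "norm z \<le> s" "0 < cmod (mixed_eval f z)"
     "cmod (mixed_eval f z) \<le> d" "cmod (mixed_eval f z * exp w) \<le> d"
      using that by (auto simp: A_def p transport_domain_def)
    have s: "0 < s" using A r by auto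
    have "liftable (w, c) (s, (1 / s) *\<^sub>R z)"
      unfolding liftable_def
    proof (intro conjI ballI allI impI)
      show "norm (snd (s, (1 / s) *\<^sub>R z)) \<le> 1" using s A by simp
      fix \<theta> :: real and y
      assume \<theta>: "\<theta> \<in> {0..1}" and y: "norm y \<le> 1"
        and eq: "mixed_eval f (fst (fst (s, (1 / s) *\<^sub>R z) + snd (w, c) * \<theta>, y) *\<^sub>R
            snd (fst (s, (1 / s) *\<^sub>R z) + snd (w, c) * \<theta>, y)) =
          mixed_eval f (fst (s, (1 / s) *\<^sub>R z) *\<^sub>R snd (s, (1 / s) *\<^sub>R z)) * exp (of_real \<theta> * fst (w, c))"
      then have eq: "mixed_eval f ((s + c * \<theta>) *\<^sub>R y) = mixed_eval f z * exp (of_real \<theta> * w)"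
        using s by simp
      have "s + c * \<theta> = (1 - \<theta>) *\<^sub>R s + \<theta> *\<^sub>R (s + c)" by (simp add: algebra_simps)
      also have "\<dots> \<in> {r..\<rho>}"
        using A \<theta> by (intro convexD) auto
      finally have 1: "s + c * \<theta> \<in> {r..\<rho>}" .
      have "exp (\<theta> * Re w) \<le> max 1 (exp (Re w))"
      proof (cases "0 \<le> Re w")
        case True
        then have "\<theta> * Re w \<le> Re w" using \<theta> by (simp add: mult_left_le_one_le)
        then show ?thesis by (simp add: le_max_iff_disj)
      next
        case False
        then have "\<theta> * Re w \<le> 0" using \<theta> by (simp add: mult_nonneg_nonpos)
        then show ?thesis by (simp add: le_max_iff_disj)
      qed
      then have "cmod (mixed_eval f z) * exp (\<theta> * Re w) \<le> cmod (mixed_eval f z) * max 1 (exp (Re w))"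
        by (intro mult_left_mono) auto
      also have "\<dots> \<le> d"
        using A by (auto simp: max_def norm_mult norm_exp_eq_Re)
      finally have 2: "cmod (mixed_eval f ((s + c * \<theta>) *\<^sub>R y)) \<le> d"
        unfolding eq by (simp add: norm_mult norm_exp_eq_Re)
      have 3: "0 < cmod (mixed_eval f ((s + c * \<theta>) *\<^sub>R y))"
        unfolding eq using A by simp
      show "0 < gram (fst (s, (1 / s) *\<^sub>R z) + snd (w, c) * \<theta>, y)"
        using pos[OF 1 y 3 2] by simp
    qed
    then show ?thesis by (simp add: \<iota>_def p)
  qed
  have cont: "continuous_on A \<Phi>"
  proof -
    have "continuous_on A \<iota>"
      unfolding \<iota>_def using r by (intro continuous_intros) (auto simp: A_def transport_domain_def)
    then have "continuous_on A (\<lambda>p. transport (fst (\<iota> p)) (snd (\<iota> p)))"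
      by (rule continuous_on_compose2[OF continuous_on_transport]) (use liftable in auto)
    then show ?thesis unfolding \<Phi>_def by (intro continuous_intros)
  qed
  show ?thesis
  proof (rule that[OF cont[unfolded A_def]])
    fix w c s z assume p: "((w, c), (s, z)) \<in> transport_domain f r \<rho> d"
    then have s: "0 < s" "0 < s + c" using r by (auto simp: transport_domain_def)
    let ?x = "(s, (1 / s) *\<^sub>R z)" and ?k = "(w, c)"
    have l: "liftable ?k ?x" using liftable[of "(?k, (s, z))"] p by (simp add: \<iota>_def A_def)
    have \<Phi>: "\<Phi> (?k, (s, z)) = (s + c) *\<^sub>R snd (transport ?k ?x)" by (simp add: \<Phi>_def \<iota>_def)
    have fst: "fst (transport ?k ?x) = s + c" using transport_fst[OF l] by simp
    have "norm (\<Phi> (?k, (s, z))) \<le> (s + c) * 1"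
      unfolding \<Phi> norm_scaleR using s transport_norm[OF l] by (intro mult_mono) auto
    moreover have "mixed_eval f (\<Phi> (?k, (s, z))) = mixed_eval f z * exp w"
      using transport_F[OF l] s unfolding fst \<Phi> by simp
    moreover have "\<Phi> ((- w, - c), (s + c, \<Phi> (?k, (s, z)))) = s *\<^sub>R snd (transport (- ?k) (transport ?k ?x))"
    proof -
      have "(s + c, snd (transport ?k ?x)) = transport ?k ?x" using fst by (metis prod.collapse)
      then show ?thesis unfolding \<Phi> using s by (simp add: \<Phi>_def \<iota>_def)
    qed
    then have "\<Phi> ((- w, - c), (s + c, \<Phi> (?k, (s, z)))) = z"
      unfolding transport_inverse[OF l] using s by simp
    ultimately show "norm (\<Phi> (?k, (s, z))) \<le> s + c \<and> mixed_eval f (\<Phi> (?k, (s, z))) = mixed_eval f z * exp w \<and>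
       \<Phi> ((- w, - c), (s + c, \<Phi> (?k, (s, z)))) = z" by simp
  qed
qed

section \<open>Values of a mixed polynomial near the origin\<close>

text \<open>On the curve \<open>a i = x\<^sup>e\<^sup>(\<^sup>i\<^sup>)\<close> with distinct exponents, the sum is a nonzero polynomial in
  \<open>x\<close> for each \<open>v\<close>, so all but finitely many \<open>x\<close> will do.\<close>

lemma separating_weight:
  fixes V :: "('n::finite \<Rightarrow> int) set"
  assumes "finite V" "\<And>v. v \<in> V \<Longrightarrow> v \<noteq> (\<lambda>i. 0)"
  obtains a :: "'n \<Rightarrow> nat" where "\<And>i. 0 < a i" "\<And>v. v \<in> V \<Longrightarrow> (\<Sum>i\<in>UNIV. int (a i) * v i) \<noteq> 0"
proof -
  obtain e :: "'n \<Rightarrow> nat" where e: "inj e"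
    using finite_imp_inj_to_nat_seg[of "UNIV :: 'n set"] by auto
  define p where "p v = (\<Sum>i\<in>UNIV. monom (v i) (e i))" for v :: "'n \<Rightarrow> int"
  have "p v \<noteq> 0" if v: "v \<in> V" for v
  proof -
    obtain j where "v j \<noteq> 0" using assms(2)[OF v] by auto
    moreover have "coeff (p v) (e j) = v j"
      using e by (simp add: p_def coeff_sum inj_eq)
    ultimately show ?thesis by auto
  qed
  then have "finite (\<Union>v\<in>V. {x. poly (p v) x = 0})"
    using assms(1) by (intro finite_UN_I poly_roots_finite)
  moreover have "infinite {1::int..}" by (rule infinite_Ici)
  ultimately have "\<not> {1..} \<subseteq> (\<Union>v\<in>V. {x. poly (p v) x = 0})"
    using finite_subset by blast
  then obtain x where x: "x \<ge> 1" "\<And>v. v \<in> V \<Longrightarrow> poly (p v) x \<noteq> 0" by blast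
  have "poly (p v) x = (\<Sum>i\<in>UNIV. int (nat x ^ e i) * v i)" for v
    using x(1) by (simp add: p_def poly_sum poly_monom mult.commute)
  then show ?thesis using x by (intro that[of "\<lambda>i. nat x ^ e i"]) auto
qed

text \<open>With \<open>w = t u\<close> and \<open>|u| = 1\<close>, the monomial \<open>w\<^sup>A (cnj w)\<^sup>B\<close> becomes \<open>t\<^sup>A\<^sup>+\<^sup>B u\<^sup>A\<^sup>-\<^sup>B\<close>.
  Comparing coefficients first in \<open>u\<close> and then in \<open>t\<close> separates the pairs \<open>(A, B)\<close>. The shift
  by \<open>M\<close> avoids negative exponents.\<close>

lemma mixed_monomials_independent:
  fixes c :: "'k \<Rightarrow> complex" and A B :: "'k \<Rightarrow> nat"
  assumes K: "finite K" and inj: "inj_on (\<lambda>k. (A k, B k)) K" and e: "0 < e"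
    and zero: "\<And>w. 0 < cmod w \<Longrightarrow> cmod w < e \<Longrightarrow> (\<Sum>k\<in>K. c k * w ^ A k * cnj w ^ B k) = 0"
    and k: "k \<in> K"
  shows "c k = 0"
proof -
  define M where "M = (\<Sum>k\<in>K. B k)"
  have M: "B k \<le> M" if "k \<in> K" for k
    unfolding M_def using that K by (intro member_le_sum) auto
  have circle: "infinite {u::complex. cmod u = 1}"
  proof
    assume "finite {u::complex. cmod u = 1}"
    then have "finite (Re ` {u. cmod u = 1})" by (rule finite_imageI)
    moreover have "{0..1::real} \<subseteq> Re ` {u. cmod u = 1}"
    proof
      fix x :: real assume "x \<in> {0..1}"
      then have "0 \<le> 1 - x\<^sup>2" by (simp add: power_le_one)
      then show "x \<in> Re ` {u. cmod u = 1}"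
        by (intro image_eqI[of _ _ "Complex x (sqrt (1 - x\<^sup>2))"]) (auto simp: cmod_def)
    qed
    ultimately have "finite {0..1::real}" by (rule finite_subset[rotated])
    then show False using infinite_Icc[of "0::real" 1] by simp
  qed
  define j where "j = A k + M - B k"
  define Q where "Q = (\<Sum>k | k \<in> K \<and> A k + M - B k = j. monom (c k) (A k + B k))"
  have Q0: "poly Q (of_real t) = 0" if t: "0 < t" "t < e" for t :: real
  proof -
    define P where "P = (\<Sum>k\<in>K. monom (c k * of_real t ^ (A k + B k)) (A k + M - B k))"
    have "poly P u = 0" if u: "cmod u = 1" for u
    proof -
      have "u * cnj u = 1" using u by (simp add: complex_norm_square[symmetric])
      have "u ^ (A k + M - B k) = u ^ M * (u ^ A k * cnj u ^ B k)" if "k \<in> K" for k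
      proof -
        have "u ^ M = u ^ (M - B k) * u ^ B k" using M[OF that] by (simp flip: power_add)
        then have "u ^ M * (u ^ A k * cnj u ^ B k) = u ^ (M - B k) * u ^ A k * (u * cnj u) ^ B k"
          by (simp add: power_mult_distrib mult_ac)
        also have "\<dots> = u ^ (A k + M - B k)"
          using M[OF that] \<open>u * cnj u = 1\<close> by (simp add: add.commute flip: power_add)
        finally show ?thesis by simp
      qed
      then have "poly P u = (\<Sum>k\<in>K. u ^ M * (c k * (of_real t * u) ^ A k * cnj (of_real t * u) ^ B k))"
        unfolding P_def poly_sum
        by (intro sum.cong) (auto simp: poly_monom power_mult_distrib power_add mult_ac)
      also have "\<dots> = 0"
        using zero[of "of_real t * u"] u t by (simp add: norm_mult flip: sum_distrib_left)
      finally show ?thesis .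
    qed
    then have "{u. cmod u = 1} \<subseteq> {u. poly P u = 0}" by blast
    then have "infinite {u. poly P u = 0}" using circle finite_subset by blast
    then have "P = 0" using poly_roots_finite by blast
    then have "0 = coeff P j" by simp
    also have "\<dots> = (\<Sum>k\<in>K. if A k + M - B k = j then c k * of_real t ^ (A k + B k) else 0)"
      by (simp add: P_def coeff_sum)
    also have "\<dots> = (\<Sum>k | k \<in> K \<and> A k + M - B k = j. c k * of_real t ^ (A k + B k))"
      using K by (simp add: sum.inter_filter)
    also have "\<dots> = poly Q (of_real t)"
      by (simp add: Q_def poly_sum poly_monom)
    finally show ?thesis by simp
  qed
  have "infinite (complex_of_real ` {0<..<e})"
    using e by (simp add: finite_image_iff inj_on_def)
  moreover have "complex_of_real ` {0<..<e} \<subseteq> {u. poly Q u = 0}" using Q0 by auto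
  ultimately have "infinite {u. poly Q u = 0}" using finite_subset by blast
  then have "Q = 0" using poly_roots_finite by blast
  then have "0 = coeff Q (A k + B k)" by simp
  also have "\<dots> = (\<Sum>l | l \<in> K \<and> A l + M - B l = j. if l = k then c l else 0)"
    unfolding Q_def coeff_sum
  proof (rule sum.cong)
    fix l assume l: "l \<in> {l \<in> K. A l + M - B l = j}"
    have "l = k" if "A l + B l = A k + B k"
    proof -
      have "A l + M - B l = A k + M - B k" using l by (simp add: j_def)
      then have "A l = A k \<and> B l = B k" using that M[of l] M[of k] l k by auto
      then show ?thesis using inj l k by (auto simp: inj_on_def)
    qed
    then show "coeff (monom (c l) (A l + B l)) (A k + B k) = (if l = k then c l else 0)"
      by auto
  qed simp
  also have "\<dots> = c k" using K k by (simp add: sum.delta' j_def)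
  finally show ?thesis by simp
qed

text \<open>Restricting to the curve \<open>z\<^sub>i = w\<^sup>a\<^sup>(\<^sup>i\<^sup>)\<close> with separating weights \<open>a\<close> keeps the monomials
  distinct and reduces the claim to one variable.\<close>

lemma mixed_eval_not_locally_zero:
  fixes f :: "'n::finite mixed_poly"
  assumes "f \<noteq> 0" "0 < e"
  obtains z where "norm z < e" "mixed_eval f z \<noteq> 0"
proof -
  note found = that
  let ?K = "Poly_Mapping.keys f"
  define V where "V = {v. (\<exists>k\<in>?K. \<exists>l\<in>?K. v = (\<lambda>i. int (fst k i) - int (fst l i)) \<or>
      v = (\<lambda>i. int (snd k i) - int (snd l i))) \<and> v \<noteq> (\<lambda>i. 0)}"
  have "V \<subseteq> (\<lambda>(k, l) i. int (fst k i) - int (fst l i)) ` (?K \<times> ?K)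
      \<union> (\<lambda>(k, l) i. int (snd k i) - int (snd l i)) ` (?K \<times> ?K)"
    unfolding V_def by (auto simp: image_iff)
  then have "finite V" by (rule finite_subset) auto
  have V0: "v \<noteq> (\<lambda>i. 0)" if "v \<in> V" for v using that by (simp add: V_def)
  obtain a :: "'n \<Rightarrow> nat" where a: "\<And>i. 0 < a i"
    "\<And>v. v \<in> V \<Longrightarrow> (\<Sum>i\<in>UNIV. int (a i) * v i) \<noteq> 0"
    by (rule separating_weight[OF \<open>finite V\<close> V0], assumption, rule that)
  define A B where "A k = (\<Sum>i\<in>UNIV. a i * fst k i)" and "B k = (\<Sum>i\<in>UNIV. a i * snd k i)"
    for k :: "('n \<Rightarrow> nat) \<times> ('n \<Rightarrow> nat)"
  have sep: "g = h" if "(\<lambda>i. int (g i) - int (h i)) \<noteq> (\<lambda>i. 0) \<Longrightarrow> (\<lambda>i. int (g i) - int (h i)) \<in> V"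
    "(\<Sum>i\<in>UNIV. a i * g i) = (\<Sum>i\<in>UNIV. a i * h i)" for g h
  proof (rule ccontr)
    assume "g \<noteq> h"
    then have "(\<lambda>i. int (g i) - int (h i)) \<in> V" using that(1) by (auto simp: fun_eq_iff)
    from a(2)[OF this] have "int (\<Sum>i\<in>UNIV. a i * g i) \<noteq> int (\<Sum>i\<in>UNIV. a i * h i)"
      by (simp add: right_diff_distrib sum_subtractf)
    then show False using that(2) by simp
  qed
  have inj: "inj_on (\<lambda>k. (A k, B k)) ?K"
  proof (rule inj_onI)
    fix k l assume kl: "k \<in> ?K" "l \<in> ?K" "(A k, B k) = (A l, B l)"
    have "fst k = fst l" by (rule sep) (use kl in \<open>auto simp: A_def V_def\<close>)
    moreover have "snd k = snd l" by (rule sep) (use kl in \<open>auto simp: B_def V_def\<close>)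
    ultimately show "k = l" by (rule prod_eqI)
  qed
  define curve where "curve w = (\<chi> i. w ^ a i)" for w :: complex
  have eval: "mixed_eval f (curve w) = (\<Sum>k\<in>?K. Poly_Mapping.lookup f k * w ^ A k * cnj w ^ B k)" for w
    unfolding mixed_eval_def curve_def A_def B_def
    by (intro sum.cong)
      (auto simp: prod.distrib power_sum mult.assoc simp flip: power_mult complex_cnj_power)
  define r where "r = min 1 (e / CARD('n))"
  have "0 < r" using assms by (simp add: r_def)
  obtain k where k: "k \<in> ?K" using assms(1) by (metis ex_in_conv keys_eq_empty)
  show ?thesis
  proof (rule ccontr)
    assume no: "\<not> thesis"
    have zero: "mixed_eval f z = 0" if "norm z < e" for z
      using no found[OF that] by blast
    have "norm (curve w) < e" if "cmod w < r" for w
    proof -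
      have "norm (curve w) \<le> (\<Sum>i\<in>UNIV. norm (curve w $ i))"
        unfolding norm_vec_def by (rule L2_set_le_sum) simp
      also have "\<dots> \<le> (\<Sum>i\<in>(UNIV::'n set). cmod w)"
      proof (rule sum_mono)
        fix i
        have "cmod w ^ a i \<le> cmod w ^ 1"
          using that a(1)[of i] by (intro power_decreasing) (auto simp: r_def)
        then show "norm (curve w $ i) \<le> cmod w" by (simp add: curve_def norm_power)
      qed
      also have "\<dots> < e" using that by (simp add: r_def field_simps)
      finally show ?thesis .
    qed
    then have "(\<Sum>k\<in>?K. Poly_Mapping.lookup f k * w ^ A k * cnj w ^ B k) = 0" if "cmod w < r" for w
      using zero that unfolding eval[symmetric] by blast
    then have "Poly_Mapping.lookup f k = 0"
      by (rule mixed_monomials_independent[OF finite_keys inj \<open>0 < r\<close> _ k])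
    then show False using k by (simp add: in_keys_iff)
  qed
qed

lemma mixed_eval_zero: "mixed_eval f 0 = Poly_Mapping.lookup f (\<lambda>i. 0, \<lambda>i. 0)"
proof -
  have "(\<Prod>i\<in>UNIV. (0::complex) ^ \<nu> i * cnj 0 ^ \<mu> i) = (if (\<nu>, \<mu>) = (\<lambda>i. 0, \<lambda>i. 0) then 1 else 0)"
    for \<nu> \<mu> :: "'n::finite \<Rightarrow> nat"
  proof (cases "\<exists>i. \<nu> i \<noteq> 0 \<or> \<mu> i \<noteq> 0")
    case True
    then obtain i where "\<nu> i \<noteq> 0 \<or> \<mu> i \<noteq> 0" by blast
    then have "(0::complex) ^ \<nu> i * cnj 0 ^ \<mu> i = 0" by (auto simp: power_0_left)
    then have "(\<Prod>i\<in>UNIV. (0::complex) ^ \<nu> i * cnj 0 ^ \<mu> i) = 0"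
      by (intro prod_zero) auto
    then show ?thesis using True by (auto simp: fun_eq_iff)
  qed auto
  then have "mixed_eval f 0 = (\<Sum>k\<in>Poly_Mapping.keys f.
      if k = (\<lambda>i. 0, \<lambda>i. 0) then Poly_Mapping.lookup f k else 0)"
    unfolding mixed_eval_def by (intro sum.cong) (auto split: if_splits)
  then show ?thesis by (simp add: sum.delta' in_keys_iff)
qed

text \<open>With a constant term the Newton polyhedron is the whole orthant, and the origin is its
  vertex.\<close>

lemma constant_term_face:
  fixes f :: "'n::finite mixed_poly"
  assumes "Poly_Mapping.lookup f (\<lambda>i. 0, \<lambda>i. 0) \<noteq> 0"
  shows "compact_newton_face f {0}"
proof -
  let ?O = "{\<xi> :: real ^ 'n. \<forall>i. 0 \<le> \<xi> $ i}"
  have "convex ?O" by (auto simp: convex_def)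
  then have sub: "newton_polyhedron f \<subseteq> ?O"
    unfolding newton_polyhedron_def by (intro hull_minimal) (auto simp: exponent_def)
  have "(\<lambda>i. 0, \<lambda>i. 0) \<in> Poly_Mapping.keys f" using assms by (simp add: in_keys_iff)
  then have 0: "0 \<in> newton_polyhedron f"
    unfolding newton_polyhedron_def
    by (intro hull_inc UN_I[of "(\<lambda>i. 0, \<lambda>i. 0)"]) (auto simp: exponent_def vec_eq_iff intro!: exI[of _ 0])
  have "0 extreme_point_of newton_polyhedron f"
    unfolding extreme_point_of_def
  proof (intro conjI 0 ballI)
    fix a b assume ab: "a \<in> newton_polyhedron f" "b \<in> newton_polyhedron f"
    show "0 \<notin> open_segment a b"
    proof
      assume "0 \<in> open_segment a b"
      then obtain u where u: "a \<noteq> b" "0 < u" "u < 1" "0 = (1 - u) *\<^sub>R a + u *\<^sub>R b"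
        by (auto simp: in_segment)
      have "a $ i = b $ i" for i
      proof -
        have "0 \<le> a $ i" "0 \<le> b $ i" using ab sub by auto
        moreover have "(1 - u) * a $ i + u * b $ i = 0"
          using arg_cong[OF u(4), of "\<lambda>x. x $ i"] by simp
        ultimately show ?thesis using u(2,3)
          by (smt (verit) mult_nonneg_nonneg mult_pos_pos)
      qed
      then show False using u(1) by (simp add: vec_eq_iff)
    qed
  qed
  then show ?thesis by (simp add: compact_newton_face_def face_of_singleton)
qed

text \<open>Otherwise the face function of the vertex \<open>0\<close> would be a nonzero constant, all of whose
  points are critical.\<close>

lemma strongly_nondegenerate_imp_zero_at_origin:
  fixes f :: "'n::finite mixed_poly"
  assumes "strongly_nondegenerate f"
  shows "mixed_eval f 0 = 0"
proof (rule ccontr)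
  assume "mixed_eval f 0 \<noteq> 0"
  then have "compact_newton_face f {0}" by (intro constant_term_face) (simp add: mixed_eval_zero)
  moreover define z :: "complex ^ 'n" where "z = (\<chi> i. 1)"
  moreover have "z \<in> coord_torus UNIV" by (simp add: z_def coord_torus_def coord_space_def)
  ultimately have "\<not> critical_point (face_fun f {0}) z"
    using assms unfolding strongly_nondegenerate_def by blast
  moreover have "face_fun f {0} = (\<lambda>z. face_fun f {0} 0)"
  proof
    fix z
    have key: "\<nu> = (\<lambda>i. 0) \<and> \<mu> = (\<lambda>i. 0)" if "(\<nu>, \<mu>) \<in> Poly_Mapping.keys (face_part f {0})" for \<nu> \<mu>
    proof -
      have "exponent (\<nu>, \<mu>) = 0"
        using that by (auto simp: face_part_def in_keys_iff mapp.rep_eq when_def split: if_splits)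
      then show ?thesis by (auto simp: exponent_def vec_eq_iff fun_eq_iff simp flip: of_nat_add)
    qed
    then show "face_fun f {0} z = face_fun f {0} 0"
      unfolding mixed_eval_def by (intro sum.cong) (auto dest!: key)
  qed
  then have "frechet_derivative (face_fun f {0}) (at z) = (\<lambda>v. 0)"
    by (metis frechet_derivative_const)
  ultimately show False by (simp add: critical_along_def image_constant_conv)
qed

section \<open>Fibrations of tubes\<close>

lemma fibration_isomorphic_over_trans:
  assumes "fibration_isomorphic_over \<sigma> p E B p' E' B'"
    and "fibration_isomorphic_over \<sigma>' p' E' B' p'' E'' B''"
  shows "fibration_isomorphic_over (\<lambda>\<eta>. \<sigma>' (\<sigma> \<eta>)) p E B p'' E'' B''"
proof -
  obtain \<tau> h k where 1: "homeomorphism B B' \<sigma> \<tau>" "homeomorphism E E' h k"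
    "\<And>x. x \<in> E \<Longrightarrow> p' (h x) = \<sigma> (p x)"
    using assms(1) unfolding fibration_isomorphic_over_def by blast
  obtain \<tau>' h' k' where 2: "homeomorphism B' B'' \<sigma>' \<tau>'" "homeomorphism E' E'' h' k'"
    "\<And>x. x \<in> E' \<Longrightarrow> p'' (h' x) = \<sigma>' (p' x)"
    using assms(2) unfolding fibration_isomorphic_over_def by blast
  have "h x \<in> E'" if "x \<in> E" for x using 1(2) that by (auto simp: homeomorphism_def)
  then have "\<forall>x\<in>E. p'' ((h' \<circ> h) x) = \<sigma>' (\<sigma> (p x))" using 1(3) 2(3) by simp
  then show ?thesis
    using homeomorphism_compose[OF 1(1) 2(1)] homeomorphism_compose[OF 1(2) 2(2)]
    unfolding fibration_isomorphic_over_def by (auto simp: o_def)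
qed

text \<open>Transport by \<open>w = ln \<kappa>\<close> multiplies \<open>f\<close> by \<open>\<kappa>\<close>, and transport by \<open>-w\<close> with the opposite
  change of radius is its inverse. The statement is for an arbitrary part \<open>B\<close> of the base,
  which covers the tube and its boundary at once.\<close>

lemma scaling_isomorphic:
  fixes f :: "'n::finite mixed_poly"
  assumes r: "0 < r" and level: "stable_level f \<rho> r d"
    and s: "s \<in> {r..\<rho>}" "s' \<in> {r..\<rho>}" and \<kappa>: "0 < \<kappa>"
    and B: "B \<subseteq> {\<eta>. 0 < cmod \<eta> \<and> cmod \<eta> \<le> d}" "B' \<subseteq> {\<eta>. 0 < cmod \<eta> \<and> cmod \<eta> \<le> d}"
    and B': "B' = (\<lambda>\<eta>. of_real \<kappa> * \<eta>) ` B"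
  shows "fibration_isomorphic_over (\<lambda>\<eta>. of_real \<kappa> * \<eta>)
    (mixed_eval f) (mixed_eval f -` B \<inter> cball 0 s) B (mixed_eval f) (mixed_eval f -` B' \<inter> cball 0 s') B'"
proof -
  obtain \<Phi> where \<Phi>: "continuous_on (transport_domain f r \<rho> d) \<Phi>"
    "\<And>w c s z. ((w, c), (s, z)) \<in> transport_domain f r \<rho> d \<Longrightarrow>
       norm (\<Phi> ((w, c), (s, z))) \<le> s + c \<and> mixed_eval f (\<Phi> ((w, c), (s, z))) = mixed_eval f z * exp w \<and>
       \<Phi> ((- w, - c), (s + c, \<Phi> ((w, c), (s, z)))) = z"
    using fiber_transport[OF r level] by blast
  define w where "w = complex_of_real (ln \<kappa>)"
  have ew: "exp w = of_real \<kappa>" "exp (- w) = inverse (of_real \<kappa>)"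
    using \<kappa> by (simp_all add: w_def exp_of_real exp_minus)
  define h where "h z = \<Phi> ((w, s' - s), (s, z))" for z
  define k where "k z = \<Phi> ((- w, s - s'), (s', z))" for z
  let ?E = "mixed_eval f -` B \<inter> cball 0 s" and ?E' = "mixed_eval f -` B' \<inter> cball 0 s'"
  have inB: "of_real \<kappa> * \<eta> \<in> B'" if "\<eta> \<in> B" for \<eta> using that B' by blast
  have inB': "inverse (of_real \<kappa>) * \<eta> \<in> B" if "\<eta> \<in> B'" for \<eta>
    using that \<kappa> unfolding B' by (auto simp: mult.assoc[symmetric])
  have dom: "((w, s' - s), (s, z)) \<in> transport_domain f r \<rho> d" if "z \<in> ?E" for z
    using that s B inB[of "mixed_eval f z"] by (auto simp: transport_domain_def ew mult.commute)
  have dom': "((- w, s - s'), (s', z)) \<in> transport_domain f r \<rho> d" if "z \<in> ?E'" for z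
    using that s B inB'[of "mixed_eval f z"] by (auto simp: transport_domain_def ew mult.commute)
  have f_h: "mixed_eval f (h z) = of_real \<kappa> * mixed_eval f z" and h: "h z \<in> ?E'" and kh: "k (h z) = z"
    if "z \<in> ?E" for z
    using \<Phi>(2)[OF dom[OF that]] inB[of "mixed_eval f z"] that
    by (auto simp: h_def k_def ew mult.commute)
  have k: "k z \<in> ?E" and hk: "h (k z) = z" if "z \<in> ?E'" for z
    using \<Phi>(2)[OF dom'[OF that]] inB'[of "mixed_eval f z"] that
    by (auto simp: h_def k_def ew mult.commute)
  have "continuous_on ?E h"
    unfolding h_def by (rule continuous_on_compose2[OF \<Phi>(1)]) (auto intro!: continuous_intros dom)
  moreover have "continuous_on ?E' k"
    unfolding k_def by (rule continuous_on_compose2[OF \<Phi>(1)]) (auto intro!: continuous_intros dom')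
  ultimately have "homeomorphism ?E ?E' h k"
    using h k kh hk by (intro homeomorphismI) blast+
  moreover have "homeomorphism B B' (\<lambda>\<eta>. of_real \<kappa> * \<eta>) (\<lambda>\<eta>. inverse (of_real \<kappa>) * \<eta>)"
    using \<kappa> inB inB' by (intro homeomorphismI) (auto intro!: continuous_intros)
  ultimately show ?thesis
    unfolding fibration_isomorphic_over_def using f_h by blast
qed

text \<open>Transport by \<open>Ln (u / b)\<close> takes the fiber over \<open>b\<close> to the fiber over \<open>u\<close>; it is continuous
  in \<open>u\<close> on the disc \<open>|u / b - 1| < 1\<close>, which avoids the branch cut. Transport from the point
  \<open>z\<^sub>0\<close> alone reaches every point of \<open>B\<close>, hence surjectivity.\<close>

lemma locally_trivial_over:
  fixes f :: "'n::finite mixed_poly"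
  assumes r: "0 < r" "r \<le> \<rho>" and level: "stable_level f \<rho> r d"
    and B: "B \<subseteq> {\<eta>. 0 < cmod \<eta> \<and> cmod \<eta> \<le> d}"
    and z\<^sub>0: "norm z\<^sub>0 \<le> r" "0 < cmod (mixed_eval f z\<^sub>0)" "cmod (mixed_eval f z\<^sub>0) \<le> d"
  shows "locally_trivial_fibration (mixed_eval f) (mixed_eval f -` B \<inter> cball 0 r) B"
proof -
  obtain \<Phi> where \<Phi>: "continuous_on (transport_domain f r \<rho> d) \<Phi>"
    "\<And>w c s z. ((w, c), (s, z)) \<in> transport_domain f r \<rho> d \<Longrightarrow>
       norm (\<Phi> ((w, c), (s, z))) \<le> s + c \<and> mixed_eval f (\<Phi> ((w, c), (s, z))) = mixed_eval f z * exp w \<and>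
       \<Phi> ((- w, - c), (s + c, \<Phi> ((w, c), (s, z)))) = z"
    using fiber_transport[OF r(1) level] by blast
  define h where "h w z = \<Phi> ((w, 0), (r, z))" for w z
  have dom: "((w, 0), (r, z)) \<in> transport_domain f r \<rho> d"
    if "norm z \<le> r" "0 < cmod (mixed_eval f z)" "cmod (mixed_eval f z) \<le> d"
      "cmod (mixed_eval f z * exp w) \<le> d" for w z
    using that r by (simp add: transport_domain_def)
  have h: "norm (h w z) \<le> r" "mixed_eval f (h w z) = mixed_eval f z * exp w" "h (- w) (h w z) = z"
    if "norm z \<le> r" "0 < cmod (mixed_eval f z)" "cmod (mixed_eval f z) \<le> d"
      "cmod (mixed_eval f z * exp w) \<le> d" for w z
    using \<Phi>(2)[OF dom[OF that]] by (simp_all add: h_def)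
  let ?E = "mixed_eval f -` B \<inter> cball 0 r"
  have image: "mixed_eval f ` ?E = B"
  proof (intro equalityI subsetI)
    fix u assume u: "u \<in> B"
    define w where "w = Ln (u / mixed_eval f z\<^sub>0)"
    have "mixed_eval f z\<^sub>0 * exp w = u" using u B z\<^sub>0 by (auto simp: w_def exp_Ln)
    then show "u \<in> mixed_eval f ` ?E"
      using h[OF z\<^sub>0, of w] u B by (intro image_eqI[of _ _ "h w z\<^sub>0"]) auto
  qed auto
  have trivial: "\<exists>U \<phi> \<psi>. b \<in> U \<and> openin (top_of_set B) U \<and>
      homeomorphism (U \<times> (?E \<inter> mixed_eval f -` {b})) (?E \<inter> mixed_eval f -` U) \<phi> \<psi> \<and>
      (\<forall>u \<in> U. \<forall>x \<in> ?E \<inter> mixed_eval f -` {b}. mixed_eval f (\<phi> (u, x)) = u)" if b: "b \<in> B" for b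
  proof -
    have b0: "b \<noteq> 0" using b B by auto
    define U where "U = B \<inter> (\<lambda>u. u / b) -` ball 1 1"
    define \<phi> where "\<phi> p = h (Ln (fst p / b)) (snd p)" for p
    define \<psi> where "\<psi> z = (mixed_eval f z, h (- Ln (mixed_eval f z / b)) z)" for z
    let ?S = "U \<times> (?E \<inter> mixed_eval f -` {b})" and ?T = "?E \<inter> mixed_eval f -` U"
    have nonneg: "u / b \<notin> \<real>\<^sub>\<le>\<^sub>0" if "u \<in> U" for u
    proof
      assume "u / b \<in> \<real>\<^sub>\<le>\<^sub>0"
      then have "Re (u / b) \<le> 0" by (auto simp: complex_nonpos_Reals_iff)
      moreover have "cmod (1 - u / b) < 1" using that by (simp add: U_def dist_norm)
      then have "\<bar>Re (1 - u / b)\<bar> < 1" using abs_Re_le_cmod order_le_less_trans by blast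
      ultimately show False by simp
    qed
    have eLn: "b * exp (Ln (u / b)) = u" "u * exp (- Ln (u / b)) = b" if "u \<in> U" for u
      using that B b0 by (auto simp: U_def exp_minus)
    have U_le: "0 < cmod u" "cmod u \<le> d" if "u \<in> U" for u using that B by (auto simp: U_def)
    have b_le: "0 < cmod b" "cmod b \<le> d" using b B by auto
    have \<phi>: "norm (\<phi> (u, x)) \<le> r" "mixed_eval f (\<phi> (u, x)) = u" "h (- Ln (u / b)) (\<phi> (u, x)) = x"
      if "(u, x) \<in> ?S" for u x
      using h[of x "Ln (u / b)"] eLn[of u] U_le[of u] b_le that by (auto simp: \<phi>_def)
    have \<psi>: "norm (snd (\<psi> z)) \<le> r" "mixed_eval f (snd (\<psi> z)) = b" "\<phi> (\<psi> z) = z"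
      if "z \<in> ?T" for z
      using h[of z "- Ln (mixed_eval f z / b)"] eLn[of "mixed_eval f z"] U_le[of "mixed_eval f z"]
        b_le that by (auto simp: \<phi>_def \<psi>_def)
    have "homeomorphism ?S ?T \<phi> \<psi>"
    proof (rule homeomorphismI)
      show "continuous_on ?S \<phi>"
        unfolding \<phi>_def h_def
      proof (rule continuous_on_compose2[OF \<Phi>(1)])
        show "continuous_on ?S (\<lambda>p. ((Ln (fst p / b), 0), (r, snd p)))"
          using b0 nonneg by (intro continuous_intros) auto
        show "(\<lambda>p. ((Ln (fst p / b), 0), (r, snd p))) ` ?S \<subseteq> transport_domain f r \<rho> d"
          using eLn U_le b_le by (auto intro!: dom)
      qed
      have fc: "continuous_on ?T (mixed_eval f)" by (rule continuous_on_mixed_eval)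
      have "continuous_on ?T (\<lambda>z. h (- Ln (mixed_eval f z / b)) z)"
        unfolding h_def
      proof (rule continuous_on_compose2[OF \<Phi>(1)])
        show "continuous_on ?T (\<lambda>z. ((- Ln (mixed_eval f z / b), 0), (r, z)))"
          using b0 nonneg by (intro continuous_intros fc) auto
        show "(\<lambda>z. ((- Ln (mixed_eval f z / b), 0), (r, z))) ` ?T \<subseteq> transport_domain f r \<rho> d"
          using eLn U_le b_le by (auto intro!: dom)
      qed
      then show "continuous_on ?T \<psi>"
        unfolding \<psi>_def by (intro continuous_intros fc)
      show "\<phi> ` ?S \<subseteq> ?T" using \<phi> by (auto simp: U_def)
      show "\<psi> ` ?T \<subseteq> ?S" using \<psi> b by (auto simp: \<psi>_def)
      show "\<psi> (\<phi> p) = p" if "p \<in> ?S" for p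
        using \<phi>[of "fst p" "snd p"] that by (auto simp: \<psi>_def)
      show "\<phi> (\<psi> z) = z" if "z \<in> ?T" for z using \<psi> that by blast
    qed
    moreover have "openin (top_of_set B) U"
      unfolding U_def by (intro continuous_openin_preimage_gen continuous_intros open_ball ballI b0)
    moreover have "b \<in> U" using b b0 by (simp add: U_def)
    ultimately show ?thesis using \<phi>(2) by blast
  qed
  show ?thesis
    unfolding locally_trivial_fibration_def
    by (intro conjI ballI continuous_on_mixed_eval image trivial)
qed

lemma scale_punctured_disc:
  assumes "0 < \<kappa>"
  shows "punctured_disc (\<kappa> * \<delta>) = (\<lambda>\<eta>. of_real \<kappa> * \<eta>) ` punctured_disc \<delta>"
proof (intro set_eqI iffI)
  fix u assume u: "u \<in> punctured_disc (\<kappa> * \<delta>)"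
  then have "u / of_real \<kappa> \<in> punctured_disc \<delta>"
    using assms by (simp add: punctured_disc_def norm_divide field_simps)
  then show "u \<in> (\<lambda>\<eta>. of_real \<kappa> * \<eta>) ` punctured_disc \<delta>"
    using assms by (intro image_eqI[of _ _ "u / of_real \<kappa>"]) auto
qed (use assms in \<open>auto simp: punctured_disc_def norm_mult\<close>)

lemma scale_circle:
  assumes "0 < \<kappa>"
  shows "sphere 0 (\<kappa> * \<delta>) = (\<lambda>\<eta>::complex. of_real \<kappa> * \<eta>) ` sphere 0 \<delta>"
proof (intro set_eqI iffI)
  fix u :: complex assume u: "u \<in> sphere 0 (\<kappa> * \<delta>)"
  then have "u / of_real \<kappa> \<in> sphere 0 \<delta>"
    using assms by (simp add: norm_divide field_simps)
  then show "u \<in> (\<lambda>\<eta>. of_real \<kappa> * \<eta>) ` sphere 0 \<delta>"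
    using assms by (intro image_eqI[of _ _ "u / of_real \<kappa>"]) auto
qed (use assms in \<open>auto simp: norm_mult\<close>)

text \<open>Both radii are at least \<open>r\<close> and both levels at most \<open>d\<close>, so a single admissible level for
  \<open>r\<close> covers the whole transport.\<close>

lemma tubes_isomorphic:
  assumes r: "0 < r" and level: "stable_level f \<rho> r d"
    and s: "s \<in> {r..\<rho>}" "s' \<in> {r..\<rho>}" and \<delta>: "0 < \<delta>" "\<delta> \<le> d" "0 < \<delta>'" "\<delta>' \<le> d"
  shows "fibration_isomorphic_over (\<lambda>\<eta>. of_real (\<delta>' / \<delta>) * \<eta>)
      (mixed_eval f) (tube f s \<delta>) (punctured_disc \<delta>) (mixed_eval f) (tube f s' \<delta>') (punctured_disc \<delta>')"
    and "fibration_isomorphic_over (\<lambda>\<eta>. of_real (\<delta>' / \<delta>) * \<eta>)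
      (mixed_eval f) (tube_boundary f s \<delta>) (sphere 0 \<delta>)
      (mixed_eval f) (tube_boundary f s' \<delta>') (sphere 0 \<delta>')"
proof -
  have \<kappa>: "0 < \<delta>' / \<delta>" and eq: "\<delta>' / \<delta> * \<delta> = \<delta>'" using \<delta> by auto
  show "fibration_isomorphic_over (\<lambda>\<eta>. of_real (\<delta>' / \<delta>) * \<eta>)
      (mixed_eval f) (tube f s \<delta>) (punctured_disc \<delta>) (mixed_eval f) (tube f s' \<delta>') (punctured_disc \<delta>')"
    unfolding tube_def
    by (rule scaling_isomorphic[OF r level s \<kappa> _ _ scale_punctured_disc[OF \<kappa>, of \<delta>, unfolded eq]])
      (use \<delta> in \<open>auto simp: punctured_disc_def\<close>)
  show "fibration_isomorphic_over (\<lambda>\<eta>. of_real (\<delta>' / \<delta>) * \<eta>)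
      (mixed_eval f) (tube_boundary f s \<delta>) (sphere 0 \<delta>)
      (mixed_eval f) (tube_boundary f s' \<delta>') (sphere 0 \<delta>')"
    unfolding tube_boundary_def
    by (rule scaling_isomorphic[OF r level s \<kappa> _ _ scale_circle[OF \<kappa>, of \<delta>, unfolded eq]])
      (use \<delta> in auto)
qed

theorem theorem9:
  fixes f :: "'n::finite mixed_poly"
    and r\<Delta> :: "(real ^ 'n) set \<Rightarrow> real"
    and r\<^sub>0 \<rho>\<^sub>0 :: real
    and \<delta> :: "real \<Rightarrow> real"
  assumes "f \<noteq> 0"
    and "strongly_nondegenerate f"
    and "locally_tame_along_vanishing f"
    and "\<And>I \<Delta>. I \<in> vanishing_subsets f \<Longrightarrow> essential_face f I \<Delta> \<Longrightarrow> tame_radius f I \<Delta> (r\<Delta> \<Delta>)"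
    and "stable_radius f r\<^sub>0"
    and "\<rho>\<^sub>0 = rho_zero f r\<Delta> r\<^sub>0"
    and "\<And>r. 0 < r \<Longrightarrow> r \<le> \<rho>\<^sub>0 \<Longrightarrow> stable_level f \<rho>\<^sub>0 r (\<delta> r)"
  shows "(\<forall>r \<delta>\<^sub>0. 0 < r \<and> r \<le> \<rho>\<^sub>0 \<and> 0 < \<delta>\<^sub>0 \<and> \<delta>\<^sub>0 \<le> \<delta> r \<longrightarrow>
            locally_trivial_fibration (mixed_eval f) (tube f r \<delta>\<^sub>0) (punctured_disc \<delta>\<^sub>0) \<and>
            locally_trivial_fibration (mixed_eval f) (tube_boundary f r \<delta>\<^sub>0) (sphere 0 \<delta>\<^sub>0)) \<and>
         (\<forall>r \<delta>\<^sub>0 r' \<delta>\<^sub>0'.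
            0 < r \<and> r \<le> \<rho>\<^sub>0 \<and> 0 < \<delta>\<^sub>0 \<and> \<delta>\<^sub>0 \<le> \<delta> r \<and>
            0 < r' \<and> r' \<le> \<rho>\<^sub>0 \<and> 0 < \<delta>\<^sub>0' \<and> \<delta>\<^sub>0' \<le> \<delta> r' \<longrightarrow>
            fibration_isomorphic_over (\<lambda>\<eta>. of_real (\<delta>\<^sub>0' / \<delta>\<^sub>0) * \<eta>)
              (mixed_eval f) (tube f r \<delta>\<^sub>0) (punctured_disc \<delta>\<^sub>0)
              (mixed_eval f) (tube f r' \<delta>\<^sub>0') (punctured_disc \<delta>\<^sub>0') \<and>
            fibration_isomorphic_over (\<lambda>\<eta>. of_real (\<delta>\<^sub>0' / \<delta>\<^sub>0) * \<eta>)
              (mixed_eval f) (tube_boundary f r \<delta>\<^sub>0) (sphere 0 \<delta>\<^sub>0)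
              (mixed_eval f) (tube_boundary f r' \<delta>\<^sub>0') (sphere 0 \<delta>\<^sub>0'))"
proof (intro conjI allI impI)
  fix r \<delta>\<^sub>0 assume a: "0 < r \<and> r \<le> \<rho>\<^sub>0 \<and> 0 < \<delta>\<^sub>0 \<and> \<delta>\<^sub>0 \<le> \<delta> r"
  then have level: "stable_level f \<rho>\<^sub>0 r (\<delta> r)" using assms(7) by blast
  have "mixed_eval f 0 = 0" by (rule strongly_nondegenerate_imp_zero_at_origin[OF assms(2)])
  moreover have "isCont (mixed_eval f) 0"
    using continuous_on_mixed_eval[of UNIV f] by (simp add: continuous_on_eq_continuous_at)
  ultimately obtain e where e: "0 < e" "\<And>z. norm z < e \<Longrightarrow> cmod (mixed_eval f z) < \<delta> r"
    using a by (auto simp: continuous_at_eps_delta dist_norm)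
      (metis order_less_le_trans diff_zero)
  obtain z where z: "norm z < min e r" "mixed_eval f z \<noteq> 0"
    using mixed_eval_not_locally_zero[OF assms(1), of "min e r"] e a by auto
  have z': "norm z \<le> r" "0 < cmod (mixed_eval f z)" "cmod (mixed_eval f z) \<le> \<delta> r"
    using z e(2)[of z] by auto
  show "locally_trivial_fibration (mixed_eval f) (tube f r \<delta>\<^sub>0) (punctured_disc \<delta>\<^sub>0)"
    unfolding tube_def
    by (rule locally_trivial_over[OF _ _ level _ z']) (use a in \<open>auto simp: punctured_disc_def\<close>)
  show "locally_trivial_fibration (mixed_eval f) (tube_boundary f r \<delta>\<^sub>0) (sphere 0 \<delta>\<^sub>0)"
    unfolding tube_boundary_def
    by (rule locally_trivial_over[OF _ _ level _ z']) (use a in auto)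
next
  fix r \<delta>\<^sub>0 r' \<delta>\<^sub>0'
  assume a: "0 < r \<and> r \<le> \<rho>\<^sub>0 \<and> 0 < \<delta>\<^sub>0 \<and> \<delta>\<^sub>0 \<le> \<delta> r \<and> 0 < r' \<and> r' \<le> \<rho>\<^sub>0 \<and> 0 < \<delta>\<^sub>0' \<and> \<delta>\<^sub>0' \<le> \<delta> r'"
  then have level: "stable_level f \<rho>\<^sub>0 r (\<delta> r)" and level': "stable_level f \<rho>\<^sub>0 r' (\<delta> r')"
    using assms(7) by auto
  define \<epsilon> where "\<epsilon> = min \<delta>\<^sub>0 \<delta>\<^sub>0'"
  (* The intermediate tube: its radius \<open>s\<close> is covered by the levels of both \<open>r\<close> and \<open>r'\<close>. *)
  define s where "s = max r r'"
  have eps: "0 < \<epsilon>" "\<epsilon> \<le> \<delta> r" "\<epsilon> \<le> \<delta> r'" using a by (auto simp: \<epsilon>_def)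
  have scale: "(\<lambda>\<eta>. complex_of_real (\<delta>\<^sub>0' / \<epsilon>) * (complex_of_real (\<epsilon> / \<delta>\<^sub>0) * \<eta>))
      = (\<lambda>\<eta>. complex_of_real (\<delta>\<^sub>0' / \<delta>\<^sub>0) * \<eta>)"
    using eps by (auto simp: fun_eq_iff)
  have s: "s \<in> {r..\<rho>\<^sub>0}" "s \<in> {r'..\<rho>\<^sub>0}" "r \<in> {r..\<rho>\<^sub>0}" "r' \<in> {r'..\<rho>\<^sub>0}"
    using a by (auto simp: s_def)
  show "fibration_isomorphic_over (\<lambda>\<eta>. of_real (\<delta>\<^sub>0' / \<delta>\<^sub>0) * \<eta>)
      (mixed_eval f) (tube f r \<delta>\<^sub>0) (punctured_disc \<delta>\<^sub>0)
      (mixed_eval f) (tube f r' \<delta>\<^sub>0') (punctured_disc \<delta>\<^sub>0')"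
    using fibration_isomorphic_over_trans[OF tubes_isomorphic(1)[OF _ level s(3,1), of \<delta>\<^sub>0 \<epsilon>]
        tubes_isomorphic(1)[OF _ level' s(2,4), of \<epsilon> \<delta>\<^sub>0']] a eps
    unfolding scale by blast
  show "fibration_isomorphic_over (\<lambda>\<eta>. of_real (\<delta>\<^sub>0' / \<delta>\<^sub>0) * \<eta>)
      (mixed_eval f) (tube_boundary f r \<delta>\<^sub>0) (sphere 0 \<delta>\<^sub>0)
      (mixed_eval f) (tube_boundary f r' \<delta>\<^sub>0') (sphere 0 \<delta>\<^sub>0')"
    using fibration_isomorphic_over_trans[OF tubes_isomorphic(2)[OF _ level s(3,1), of \<delta>\<^sub>0 \<epsilon>]
        tubes_isomorphic(2)[OF _ level' s(2,4), of \<epsilon> \<delta>\<^sub>0']] a eps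
    unfolding scale by blast
qed

end
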